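(* Let $\Gamma$ be a nonbipartite dual polar graph (i.e. $e\ne-1$), fix a vertex $x$ (a $D$-dimensional vector space over $GF(q)$), and let $\mathcal P$ be the set of all subspaces of $x$. For $\eta\in\mathcal P$ define $\eta^{\mathcal N}=\sum_{y\in X,\ x\cap y=\eta}\hat y\in V$. Define $\sim$ on $X$ by $y\sim z$ iff $\partial(x,y)=\partial(x,z)=:i$ and $y,z$ lie in the same connected component of the subgraph induced on $\Gamma_i(x)=\{w\in X:\partial(x,w)=i\}$. Then the map $\eta\mapsto\eta^{\mathcal N}$ is a bijection from $\mathcal P$ to the set of characteristic vectors of the $\sim$ equivalence classes.
   Context: Dual polar graph: let $\mathbf U$ be a finite vector space with a nondegenerate form of one of the following types, with parameters $(q,e)$ ($p$ prime, $n\ge1$): $B_D(p^n)$: $\dim\mathbf U=2D+1$ over $GF(p^n)$, quadratic form, $q=p^n$, $e=0$; $C_D(p^n)$: $\dim 2D$ over $GF(p^n)$, symplectic, $q=p^n$, $e=0$; $D_D(p^n)$: $\dim 2D$ over $GF(p^n)$, quadratic of Witt index $D$, $q=p^n$, $e=-1$; ${}^2D_{D+1}(p^n)$: $\dim 2D+2$ over $GF(p^n)$, quadratic of Witt index $D$, $q=p^n$, $e=1$; ${}^2A_{2D}(p^n)$: $\dim 2D+1$ over $GF(p^{2n})$, Hermitian, $q=p^{2n}$, $e=1/2$; ${}^2A_{2D-1}(p^n)$: $\dim 2D$ over $GF(p^{2n})$, Hermitian, $q=p^{2n}$, $e=-1/2$. Here $D\ge1$ and $GF(q)$ is the field of $\mathbf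 U$. A subspace is isotropic if the form vanishes on it; maximal isotropic subspaces have dimension $D$. The dual polar graph $\Gamma$ has vertex set $X$ the maximal isotropic subspaces, with $y,z$ adjacent iff $\dim(y\cap z)=D-1$; its path-length distance is $\partial(y,z)=D-\dim(y\cap z)$. Let $V=\mathbb C^X$ with standard basis vectors $\hat y$ ($y\in X$); the characteristic vector of $C\subseteq X$ is $\sum_{y\in C}\hat y$. *)

theory Defs
  imports Complex_Main "HOL-Library.Cardinality" "HOL-Computational_Algebra.Primes"
begin

text \<open>The ambient space $U$ is a whole type \<open>'v\<close>, with a scalar multiplication \<open>scale\<close>
  by the finite field \<open>'a\<close>.\<close>

datatype ('a, 'v) form =
    Quad "'v \<Rightarrow> 'a"
  | Sesq "'v \<Rightarrow> 'v \<Rightarrow> 'a"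

definition bilinear_form :: "('a::field \<Rightarrow> 'v::ab_group_add \<Rightarrow> 'v) \<Rightarrow> ('v \<Rightarrow> 'v \<Rightarrow> 'a) \<Rightarrow> bool" where
  "bilinear_form scale B \<longleftrightarrow>
     (\<forall>u. Vector_Spaces.linear scale (*) (\<lambda>v. B u v)) \<and>
     (\<forall>v. Vector_Spaces.linear scale (*) (\<lambda>u. B u v))"

definition polarization :: "('v::ab_group_add \<Rightarrow> 'a::field) \<Rightarrow> 'v \<Rightarrow> 'v \<Rightarrow> 'a" where
  "polarization Q u v = Q (u + v) - Q u - Q v"

definition quadratic_form :: "('a::field \<Rightarrow> 'v::ab_group_add \<Rightarrow> 'v) \<Rightarrow> ('v \<Rightarrow> 'a) \<Rightarrow> bool" where
  "quadratic_form scale Q \<longleftrightarrow>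
     (\<forall>a v. Q (scale a v) = a\<^sup>2 * Q v) \<and> bilinear_form scale (polarization Q)"

text \<open>A quadratic form is nondegenerate if it has no nonzero singular vector in the radical of its
  polarization. Nondegeneracy of the polarization itself would be too strong: in characteristic 2
  it never holds in odd dimension.\<close>

definition nondegenerate_quadratic :: "('v::ab_group_add \<Rightarrow> 'a::field) \<Rightarrow> bool" where
  "nondegenerate_quadratic Q \<longleftrightarrow>
     (\<forall>v. Q v = 0 \<and> (\<forall>u. polarization Q u v = 0) \<longrightarrow> v = 0)"

definition nondegenerate_sesq :: "('v::ab_group_add \<Rightarrow> 'v \<Rightarrow> 'a::field) \<Rightarrow> bool" where
  "nondegenerate_sesq B \<longleftrightarrow> (\<forall>v. (\<forall>u. B u v = 0) \<longrightarrow> v = 0)"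

definition alternating_form :: "('a::field \<Rightarrow> 'v::ab_group_add \<Rightarrow> 'v) \<Rightarrow> ('v \<Rightarrow> 'v \<Rightarrow> 'a) \<Rightarrow> bool" where
  "alternating_form scale B \<longleftrightarrow> bilinear_form scale B \<and> (\<forall>v. B v v = 0)"

text \<open>Over the field with $r^2$ elements, conjugation is $a \mapsto a^r$.\<close>

definition hermitian_form ::
  "nat \<Rightarrow> ('a::field \<Rightarrow> 'v::ab_group_add \<Rightarrow> 'v) \<Rightarrow> ('v \<Rightarrow> 'v \<Rightarrow> 'a) \<Rightarrow> bool" where
  "hermitian_form r scale H \<longleftrightarrow>
     (\<forall>v. Vector_Spaces.linear scale (*) (\<lambda>u. H u v)) \<and> (\<forall>u v. H v u = H u v ^ r)"

fun vanishes_on :: "('a::field, 'v) form \<Rightarrow> 'v set \<Rightarrow> bool" where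
  "vanishes_on (Quad Q) W \<longleftrightarrow> (\<forall>v\<in>W. Q v = 0)"
| "vanishes_on (Sesq B) W \<longleftrightarrow> (\<forall>u\<in>W. \<forall>v\<in>W. B u v = 0)"

definition isotropic ::
  "('a::field \<Rightarrow> 'v::ab_group_add \<Rightarrow> 'v) \<Rightarrow> ('a, 'v) form \<Rightarrow> 'v set \<Rightarrow> bool" where
  "isotropic scale f W \<longleftrightarrow> module.subspace scale W \<and> vanishes_on f W"

definition witt_index ::
  "('a::field \<Rightarrow> 'v::{ab_group_add,finite} \<Rightarrow> 'v) \<Rightarrow> ('a, 'v) form \<Rightarrow> nat" where
  "witt_index scale f = Max (vector_space.dim scale ` {W. isotropic scale f W})"

text \<open>In order: $B_D(p^n)$, $C_D(p^n)$, $D_D(p^n)$, ${}^2D_{D+1}(p^n)$, ${}^2A_{2D}(p^n)$,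
  ${}^2A_{2D-1}(p^n)$.\<close>

datatype polar_type = Type_B | Type_C | Type_D | Type_2D | Type_2A_even | Type_2A_odd

fun polar_q :: "polar_type \<Rightarrow> nat \<Rightarrow> nat \<Rightarrow> nat" where
  "polar_q Type_2A_even p n = p ^ (2 * n)"
| "polar_q Type_2A_odd p n = p ^ (2 * n)"
| "polar_q _ p n = p ^ n"

fun polar_e :: "polar_type \<Rightarrow> real" where
  "polar_e Type_B = 0"
| "polar_e Type_C = 0"
| "polar_e Type_D = -1"
| "polar_e Type_2D = 1"
| "polar_e Type_2A_even = 1/2"
| "polar_e Type_2A_odd = -1/2"

fun polar_dim :: "polar_type \<Rightarrow> nat \<Rightarrow> nat" where
  "polar_dim Type_B D = 2 * D + 1"
| "polar_dim Type_C D = 2 * D"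
| "polar_dim Type_D D = 2 * D"
| "polar_dim Type_2D D = 2 * D + 2"
| "polar_dim Type_2A_even D = 2 * D + 1"
| "polar_dim Type_2A_odd D = 2 * D"

fun polar_form :: "polar_type \<Rightarrow> nat \<Rightarrow> nat \<Rightarrow> nat \<Rightarrow>
    ('a::field \<Rightarrow> 'v::{ab_group_add,finite} \<Rightarrow> 'v) \<Rightarrow> ('a, 'v) form \<Rightarrow> bool" where
  "polar_form Type_B p n D scale (Quad Q) \<longleftrightarrow>
     quadratic_form scale Q \<and> nondegenerate_quadratic Q"
| "polar_form Type_C p n D scale (Sesq B) \<longleftrightarrow>
     alternating_form scale B \<and> nondegenerate_sesq B"
| "polar_form Type_D p n D scale (Quad Q) \<longleftrightarrow>
     quadratic_form scale Q \<and> nondegenerate_quadratic Q \<and> witt_index scale (Quad Q) = D"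
| "polar_form Type_2D p n D scale (Quad Q) \<longleftrightarrow>
     quadratic_form scale Q \<and> nondegenerate_quadratic Q \<and> witt_index scale (Quad Q) = D"
| "polar_form Type_2A_even p n D scale (Sesq H) \<longleftrightarrow>
     hermitian_form (p ^ n) scale H \<and> nondegenerate_sesq H"
| "polar_form Type_2A_odd p n D scale (Sesq H) \<longleftrightarrow>
     hermitian_form (p ^ n) scale H \<and> nondegenerate_sesq H"
| "polar_form _ p n D scale _ \<longleftrightarrow> False"

definition polar_space :: "polar_type \<Rightarrow> nat \<Rightarrow> nat \<Rightarrow> nat \<Rightarrow>
    ('a::{field,finite} \<Rightarrow> 'v::{ab_group_add,finite} \<Rightarrow> 'v) \<Rightarrow> ('a, 'v) form \<Rightarrow> bool" where
  "polar_space t p n D scale f \<longleftrightarrow>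
     vector_space scale \<and>
     CARD('a) = polar_q t p n \<and>
     vector_space.dim scale (UNIV :: 'v set) = polar_dim t D \<and>
     polar_form t p n D scale f"

definition dp_vertices ::
  "('a::field \<Rightarrow> 'v::ab_group_add \<Rightarrow> 'v) \<Rightarrow> ('a, 'v) form \<Rightarrow> 'v set set" where
  "dp_vertices scale f =
     {W. isotropic scale f W \<and> (\<forall>W'. isotropic scale f W' \<and> W \<subseteq> W' \<longrightarrow> W' = W)}"

definition dp_edges ::
  "('a::field \<Rightarrow> 'v::ab_group_add \<Rightarrow> 'v) \<Rightarrow> ('a, 'v) form \<Rightarrow> nat \<Rightarrow> ('v set \<times> 'v set) set" where
  "dp_edges scale f D =
     {(y, z). y \<in> dp_vertices scale f \<and> z \<in> dp_vertices scale f \<and>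
              vector_space.dim scale (y \<inter> z) = D - 1}"

text \<open>Graphs are given by a vertex set \<open>X\<close> and a symmetric edge relation \<open>E\<close> on it. The
  path-length distance is only meaningful for vertices joined by a path; dual polar graphs are
  connected.\<close>

definition graph_dist :: "('b \<times> 'b) set \<Rightarrow> 'b \<Rightarrow> 'b \<Rightarrow> nat" where
  "graph_dist E y z = (LEAST k. (y, z) \<in> E ^^ k)"

definition subconstituent :: "'b set \<Rightarrow> ('b \<times> 'b) set \<Rightarrow> 'b \<Rightarrow> nat \<Rightarrow> 'b set" where
  "subconstituent X E x i = {w \<in> X. graph_dist E x w = i}"

definition sim_rel :: "'b set \<Rightarrow> ('b \<times> 'b) set \<Rightarrow> 'b \<Rightarrow> ('b \<times> 'b) set" where
  "sim_rel X E x =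
     {(y, z). y \<in> X \<and> z \<in> X \<and> graph_dist E x y = graph_dist E x z \<and>
              (y, z) \<in> (Restr E (subconstituent X E x (graph_dist E x y)))\<^sup>*}"

text \<open>A vector of $\mathbb{C}^X$ is a function on the type of \<open>X\<close> that is zero outside \<open>X\<close>.\<close>

definition std_basis :: "'b \<Rightarrow> 'b \<Rightarrow> complex" where
  "std_basis y = (\<lambda>w. if w = y then 1 else 0)"

definition char_vec :: "'b set \<Rightarrow> 'b \<Rightarrow> complex" where
  "char_vec C = (\<lambda>w. \<Sum>y\<in>C. std_basis y w)"

definition eta_N :: "'v set set \<Rightarrow> 'v set \<Rightarrow> 'v set \<Rightarrow> 'v set \<Rightarrow> complex" where
  "eta_N X x \<eta> = (\<lambda>w. \<Sum>y | y \<in> X \<and> x \<inter> y = \<eta>. std_basis y w)"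

end

theory Submission
  imports Defs "HOL-Computational_Algebra.Polynomial"
begin

text \<open>
  Adjacent vertices at the same distance from \<open>x\<close> meet \<open>x\<close> in the same subspace, since otherwise
  \<open>y + z\<close> would be isotropic. So everything rests on the connectedness of the set of vertices \<open>y\<close>
  with \<open>x \<inter> y = \<eta>\<close>, which is shown by induction on the codimension of \<open>\<eta>\<close> in \<open>x\<close>.

  If \<open>y\<close> and \<open>z\<close> share a vector \<open>v\<close> outside \<open>\<eta>\<close>, replace \<open>x\<close> by \<open>(x \<inter> v\<^sup>\<bottom>) + \<langle>v\<rangle>\<close> and \<open>\<eta>\<close> by
  \<open>\<eta> + \<langle>v\<rangle>\<close>. Otherwise look for orthogonal \<open>v \<in> y\<close> and \<open>w \<in> z\<close> such that \<open>\<eta> + \<langle>v, w\<rangle>\<close> meets \<open>x\<close>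
  only in \<open>\<eta>\<close>: some vertex over this space then shares a vector with each of \<open>y\<close> and \<open>z\<close>. A dimension
  count provides \<open>v\<close> and \<open>w\<close> unless the codimension of \<open>\<eta>\<close> is 2 and \<open>z\<close> is, relative to \<open>y\<close>, given by an
  alternating form. In that exceptional case \<open>y\<close> is first moved to a neighbour for which the form is no
  longer alternating. This last step fails exactly for the bipartite graphs.
\<close>

section \<open>Polar geometries\<close>

text \<open>Common ground of the three kinds of form. \<open>sing\<close> is a predicate of its own
  because in characteristic 2 a quadratic form is not determined by its polarization. Linearity is
  on the left, since a Hermitian form is semilinear on the right; nondegeneracy concerns singular
  vectors, since a polarization may have a radical.\<close>

locale polar_geometry = finite_dimensional_vector_space scale Basis
  for scale :: "'a::field \<Rightarrow> 'v::{ab_group_add,finite} \<Rightarrow> 'v" (infixr \<open>*s\<close> 75)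
    and Basis :: "'v set" +
  fixes B :: "'v \<Rightarrow> 'v \<Rightarrow> 'a" and sing :: "'v \<Rightarrow> bool"
  assumes B_add_left: "B (u + v) w = B u w + B v w"
    and B_scale_left: "B (c *s u) w = c * B u w"
    and B_reflexive: "B u v = 0 \<Longrightarrow> B v u = 0"
    and sing_scale: "sing v \<Longrightarrow> sing (c *s v)"
    and sing_add: "sing u \<Longrightarrow> sing v \<Longrightarrow> B u v = 0 \<Longrightarrow> sing (u + v)"
    and B_self: "sing v \<Longrightarrow> B v v = 0"
    and nondegenerate: "sing v \<Longrightarrow> (\<And>u. B u v = 0) \<Longrightarrow> v = 0"
begin

lemma B_zero_left [simp]: "B 0 w = 0"
  using B_scale_left[of 0 0 w] by simp

lemma B_zero_right [simp]: "B w 0 = 0"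
  by (rule B_reflexive) simp

lemma B_minus_left: "B (- u) w = - B u w"
  using B_add_left[of u "- u" w] by (simp add: eq_neg_iff_add_eq_0 add.commute)

lemma B_diff_left: "B (u - v) w = B u w - B v w"
  using B_add_left[of u "- v" w] by (simp add: B_minus_left)

lemma B_commute_0: "B u v = 0 \<longleftrightarrow> B v u = 0"
  using B_reflexive by blast

section \<open>Orthogonal subspaces and their dimensions\<close>

definition orth :: "'v set \<Rightarrow> 'v set" where
  "orth A = {u. \<forall>a\<in>A. B u a = 0}"

lemma subspace_orth: "subspace (orth A)"
  unfolding subspace_def orth_def by (auto simp: B_add_left B_scale_left)

lemma subspace_Int_orth: "subspace W \<Longrightarrow> subspace (W \<inter> orth A)"
  by (simp add: subspace_inter subspace_orth)

lemma orth_iff_subset: "A \<subseteq> orth C \<longleftrightarrow> C \<subseteq> orth A"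
  unfolding orth_def using B_commute_0 by blast

lemma orth_span: "orth (span A) = orth A"
proof
  show "orth (span A) \<subseteq> orth A"
    using span_superset unfolding orth_def by blast
  have "A \<subseteq> orth (orth A)"
    using orth_iff_subset by blast
  then have "span A \<subseteq> orth (orth A)"
    by (rule span_minimal) (rule subspace_orth)
  then show "orth A \<subseteq> orth (span A)"
    using orth_iff_subset by blast
qed

text \<open>On \<open>W\<close> the map \<open>\<lambda>u. B u a\<close> is a linear functional, so
  its kernel has codimension at most 1.\<close>

lemma dim_Int_orth_singleton:
  assumes "subspace W"
  shows "dim W \<le> dim (W \<inter> orth {a}) + 1"
proof (cases "W \<subseteq> orth {a}")
  case True
  then show ?thesis by (simp add: Int_absorb2)
next
  case False
  then obtain w where w: "w \<in> W" "B w a \<noteq> 0" by (auto simp: orth_def)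
  have "W \<subseteq> span (insert w (W \<inter> orth {a}))"
  proof
    fix u assume u: "u \<in> W"
    define k where "k = B u a / B w a"
    have "u - k *s w \<in> W"
      using assms u w by (simp add: subspace_diff subspace_scale)
    moreover have "B (u - k *s w) a = 0"
      using w by (simp add: B_diff_left B_scale_left k_def)
    ultimately have "u - k *s w \<in> span (W \<inter> orth {a})"
      by (intro span_base) (simp add: orth_def)
    then show "u \<in> span (insert w (W \<inter> orth {a}))"
      using span_breakdown_eq by blast
  qed
  then have "dim W \<le> dim (insert w (W \<inter> orth {a}))" by (rule dim_mono)
  also have "\<dots> \<le> dim (W \<inter> orth {a}) + 1" by (simp add: dim_insert)
  finally show ?thesis .
qed

lemma dim_Int_orth_card:
  assumes "subspace W"
  shows "dim W \<le> dim (W \<inter> orth C) + card C"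
proof -
  have "finite C" by simp
  then show ?thesis
  proof induction
    case empty
    then show ?case by (simp add: orth_def)
  next
    case (insert a C)
    have "dim (W \<inter> orth C) \<le> dim (W \<inter> orth C \<inter> orth {a}) + 1"
      by (rule dim_Int_orth_singleton) (simp add: assms subspace_Int_orth)
    moreover have "W \<inter> orth C \<inter> orth {a} = W \<inter> orth (insert a C)"
      by (auto simp: orth_def)
    ultimately show ?case using insert by simp
  qed
qed

lemma dim_Int_orth:
  assumes "subspace W"
  shows "dim W \<le> dim (W \<inter> orth A) + dim A"
proof -
  obtain C where C: "C \<subseteq> A" "A \<subseteq> span C" "card C = dim A"
    using basis_exists by metis
  have "orth C = orth A"
    using C by (metis orth_span span_eq span_superset subset_trans)
  then show ?thesis using dim_Int_orth_card[OF assms, of C] C by simp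
qed

section \<open>Totally isotropic subspaces\<close>

definition tot_iso :: "'v set \<Rightarrow> bool" where
  "tot_iso W \<longleftrightarrow> subspace W \<and> (\<forall>v\<in>W. sing v) \<and> W \<subseteq> orth W"

lemma tot_iso_subspace: "tot_iso W \<Longrightarrow> subspace W"
  by (simp add: tot_iso_def)

lemma tot_iso_sing: "tot_iso W \<Longrightarrow> v \<in> W \<Longrightarrow> sing v"
  by (simp add: tot_iso_def)

lemma tot_iso_B: "tot_iso W \<Longrightarrow> u \<in> W \<Longrightarrow> v \<in> W \<Longrightarrow> B u v = 0"
  by (auto simp: tot_iso_def orth_def)

lemma tot_iso_subset: "tot_iso W \<Longrightarrow> subspace V \<Longrightarrow> V \<subseteq> W \<Longrightarrow> tot_iso V"
  unfolding tot_iso_def orth_def by blast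

lemma tot_iso_insert:
  assumes W: "tot_iso W" and v: "sing v" "v \<in> orth W"
  shows "tot_iso (span (insert v W))"
proof -
  have eq: "span W = W" using W by (simp add: tot_iso_subspace)
  have vW: "B v w = 0" "B w v = 0" if "w \<in> W" for w
    using that v B_commute_0 by (auto simp: orth_def)
  have "sing u" if u: "u \<in> span (insert v W)" for u
  proof -
    obtain k where k: "u - k *s v \<in> W" using u span_breakdown_eq eq by metis
    have "sing ((u - k *s v) + k *s v)"
    proof (rule sing_add)
      show "sing (u - k *s v)" using k W tot_iso_sing by blast
      show "sing (k *s v)" using v sing_scale by blast
      have "B (k *s v) (u - k *s v) = 0" using vW k by (simp add: B_scale_left)
      then show "B (u - k *s v) (k *s v) = 0" by (rule B_reflexive)
    qed
    then show ?thesis by simp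
  qed
  moreover have "span (insert v W) \<subseteq> orth (span (insert v W))"
  proof -
    have "insert v W \<subseteq> orth (insert v W)"
      using vW W B_self[OF v(1)] by (auto simp: orth_def tot_iso_def)
    then have "span (insert v W) \<subseteq> orth (insert v W)"
      by (rule span_minimal) (rule subspace_orth)
    then show ?thesis by (simp add: orth_span)
  qed
  ultimately show ?thesis by (simp add: tot_iso_def)
qed

section \<open>Maximal totally isotropic subspaces and the Witt index\<close>

definition max_iso :: "'v set \<Rightarrow> bool" where
  "max_iso y \<longleftrightarrow> tot_iso y \<and> (\<forall>W. tot_iso W \<and> y \<subseteq> W \<longrightarrow> W = y)"

lemma max_iso_tot_iso: "max_iso y \<Longrightarrow> tot_iso y"
  by (simp add: max_iso_def)

lemma max_iso_subspace: "max_iso y \<Longrightarrow> subspace y"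
  by (simp add: max_iso_def tot_iso_def)

lemma max_iso_absorb:
  assumes "max_iso y" "sing v" "v \<in> orth y"
  shows "v \<in> y"
proof -
  have "tot_iso (span (insert v y))"
    using assms by (simp add: tot_iso_insert max_iso_def)
  moreover have "insert v y \<subseteq> span (insert v y)" by (rule span_superset)
  ultimately show ?thesis using assms unfolding max_iso_def by blast
qed

lemma max_iso_extend:
  assumes "tot_iso W"
  obtains y where "max_iso y" "W \<subseteq> y"
proof -
  obtain y where y: "y \<in> {y. tot_iso y \<and> W \<subseteq> y}"
    and m: "\<forall>z \<in> {y. tot_iso y \<and> W \<subseteq> y}. y \<subseteq> z \<longrightarrow> y = z"
    using finite_has_maximal2[of "{y. tot_iso y \<and> W \<subseteq> y}" W] assms by auto
  have "max_iso y" unfolding max_iso_def using y m by blast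
  then show thesis using that y by blast
qed

text \<open>Vectors of \<open>y \<inter> z\<close> impose no condition on \<open>z\<close>, so only
  the part \<open>F - C\<close> of a basis of \<open>y\<close> outside \<open>y \<inter> z\<close>
  counts.\<close>

lemma dim_Int_orth_tot_iso:
  assumes y: "tot_iso y" and z: "tot_iso z"
  shows "dim z + dim (y \<inter> z) \<le> dim (z \<inter> orth y) + dim y"
proof -
  obtain C where C: "C \<subseteq> y \<inter> z" "independent C" "y \<inter> z \<subseteq> span C" "card C = dim (y \<inter> z)"
    using basis_exists by metis
  obtain F where F: "C \<subseteq> F" "F \<subseteq> y" "independent F" "y \<subseteq> span F"
    using maximal_independent_subset_extend[of C y] C by auto
  have cF: "card F = dim y" using F basis_card_eq_dim by blast
  have sF: "span F = y"
    using F span_minimal[of F y] y by (auto simp: tot_iso_subspace)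
  have "z \<inter> orth (F - C) \<subseteq> z \<inter> orth y"
  proof
    fix u assume u: "u \<in> z \<inter> orth (F - C)"
    have "B u a = 0" if "a \<in> F" for a
    proof (cases "a \<in> C")
      case True
      then show ?thesis using C u z tot_iso_B by blast
    next
      case False
      then show ?thesis using u that by (auto simp: orth_def)
    qed
    then have "u \<in> orth F" by (simp add: orth_def)
    then have "u \<in> orth y" using sF orth_span by metis
    then show "u \<in> z \<inter> orth y" using u by blast
  qed
  then have "dim (z \<inter> orth (F - C)) \<le> dim (z \<inter> orth y)" by (rule dim_subset)
  moreover have "dim z \<le> dim (z \<inter> orth (F - C)) + card (F - C)"
    using z by (simp add: dim_Int_orth_card tot_iso_subspace)
  moreover have "card (F - C) + card C = card F"
    using F by (simp add: card_Diff_subset card_mono)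
  ultimately show ?thesis using C cF by simp
qed

text \<open>Singular vectors orthogonal to \<open>y\<close> lie in \<open>y\<close>, so the two
  intersections in \<open>dim_Int_orth_tot_iso\<close> cancel. In particular all maximal subspaces
  have the same dimension.\<close>

lemma max_iso_dim_ge:
  assumes y: "max_iso y" and z: "tot_iso z"
  shows "dim z \<le> dim y"
proof -
  have "z \<inter> orth y \<subseteq> y \<inter> z"
    using max_iso_absorb[OF y] tot_iso_sing[OF z] by blast
  then have "dim (z \<inter> orth y) \<le> dim (y \<inter> z)" by (rule dim_subset)
  then show ?thesis
    using dim_Int_orth_tot_iso[OF max_iso_tot_iso[OF y] z] by simp
qed

text \<open>This can fail for subspaces meeting the radical of \<open>B\<close>. Here, extend a
  basis \<open>E\<close> of \<open>orth W\<close> to a basis \<open>F\<close> of the whole space: a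
  vector of \<open>W\<close> orthogonal to \<open>F - E\<close> is orthogonal to everything and
  singular, hence 0, so \<open>dim W\<close> is at most \<open>card (F - E)\<close>.\<close>

lemma dim_orth_tot_iso:
  assumes W: "tot_iso W"
  shows "dim (orth W) + dim W = dim (UNIV :: 'v set)"
proof -
  obtain E where E: "E \<subseteq> orth W" "independent E" "orth W \<subseteq> span E" "card E = dim (orth W)"
    using basis_exists by metis
  obtain F where F: "E \<subseteq> F" "independent F" "UNIV \<subseteq> span F"
    using maximal_independent_subset_extend[of E UNIV] E by auto
  have "W \<inter> orth (F - E) \<subseteq> {0}"
  proof
    fix w assume w: "w \<in> W \<inter> orth (F - E)"
    have "w \<in> orth (orth W)" using w orth_iff_subset by blast
    then have "w \<in> orth E" using E by (auto simp: orth_def)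
    then have "w \<in> orth F" using w by (auto simp: orth_def)
    then have "w \<in> orth UNIV" using F orth_span by (metis top.extremum_uniqueI)
    then have "B u w = 0" for u using B_commute_0 by (auto simp: orth_def)
    then show "w \<in> {0}" using nondegenerate w W tot_iso_sing by blast
  qed
  then have "dim (W \<inter> orth (F - E)) = 0"
    by (simp only: dim_eq_0)
  moreover have "dim W \<le> dim (W \<inter> orth (F - E)) + card (F - E)"
    using W by (simp add: dim_Int_orth_card tot_iso_subspace)
  moreover have "card (F - E) + card E = card F"
    using F by (simp add: card_Diff_subset card_mono)
  moreover have "card F = dim (UNIV :: 'v set)" using basis_card_eq_dim[of F UNIV] F by simp
  ultimately have "dim W + dim (orth W) \<le> dim (UNIV :: 'v set)" using E(4) by linarith
  moreover have "dim (UNIV :: 'v set) \<le> dim (orth W) + dim W"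
    using dim_Int_orth[of UNIV W] by simp
  ultimately show ?thesis by simp
qed

lemma tot_iso_dim_le:
  assumes "tot_iso W"
  shows "2 * dim W \<le> dim (UNIV :: 'v set)"
proof -
  have "dim W \<le> dim (orth W)" using assms by (intro dim_subset) (simp add: tot_iso_def)
  then show ?thesis using dim_orth_tot_iso[OF assms] by linarith
qed

text \<open>A complement of \<open>y\<close> in \<open>orth y\<close> contains no nonzero singular vector; hence the Witt index is
  forced as soon as spaces of dimension \<open>m\<close> always contain such vectors.\<close>

lemma max_iso_dim_lower:
  assumes y: "max_iso y"
    and ex: "\<And>A. subspace A \<Longrightarrow> m \<le> dim A \<Longrightarrow> \<exists>v\<in>A. v \<noteq> 0 \<and> sing v"
  shows "dim (UNIV :: 'v set) < 2 * dim y + m"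
proof (rule ccontr)
  assume "\<not> ?thesis"
  then have m: "m + dim y \<le> dim (orth y)"
    using dim_orth_tot_iso[of y] y by (simp add: max_iso_def)
  obtain C where C: "C \<subseteq> y" "independent C" "y \<subseteq> span C" "card C = dim y"
    using basis_exists by metis
  have "C \<subseteq> orth y" using y C by (auto simp: max_iso_def tot_iso_def)
  then obtain F where F: "C \<subseteq> F" "F \<subseteq> orth y" "independent F" "orth y \<subseteq> span F"
    using maximal_independent_subset_extend[of C "orth y"] C by auto
  define A where "A = span (F - C)"
  have ind: "independent (F - C)" using F by (meson Diff_subset independent_mono)
  have dA: "dim A = card (F - C)"
    unfolding A_def using ind by (rule dim_span_eq_card_independent)
  also have "\<dots> = card F - card C" using F by (simp add: card_Diff_subset)
  also have "\<dots> = dim (orth y) - dim y" using basis_card_eq_dim[of F "orth y"] F C by simp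
  finally have "m \<le> dim A" using m by simp
  then obtain v where v: "v \<in> A" "v \<noteq> 0" "sing v" using ex[of A] by (auto simp: A_def)
  have "A \<subseteq> orth y"
    unfolding A_def using F by (intro span_minimal) (auto simp: subspace_orth)
  then have "v \<in> y" using v y max_iso_absorb by blast
  then have "v \<in> span C \<inter> span (F - C)" using C v A_def by auto
  moreover have "span C \<inter> span (F - C) = {0}"
  proof -
    have *: "{a + b |a b. a \<in> span C \<and> b \<in> span (F - C)} = span F"
      using span_Un[of C "F - C"] F by (simp add: Un_absorb1)
    have "dim (span C) + dim (span (F - C)) = card C + card (F - C)"
      using C(2) dA by (simp add: A_def dim_eq_card_independent)
    also have "\<dots> = card F" using F by (simp add: card_Diff_subset card_mono)
    also have "\<dots> = dim (span F)" using F by (simp add: dim_eq_card_independent)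
    finally have "dim (span C \<inter> span (F - C)) = 0"
      using dim_sums_Int[of "span C" "span (F - C)"] unfolding * by simp
    then show ?thesis using span_zero by (simp add: dim_eq_0) blast
  qed
  ultimately show False using v by blast
qed

end

section \<open>Dual polar graphs\<close>

text \<open>\<open>hyperbolic\<close> is the source of new vertices: it shifts a vector along a
  singular \<open>a\<close> until it becomes singular. Bipartite graphs are still included.\<close>

locale dual_polar = polar_geometry scale Basis B sing
  for scale :: "'a::field \<Rightarrow> 'v::{ab_group_add,finite} \<Rightarrow> 'v" (infixr \<open>*s\<close> 75)
    and Basis :: "'v set" and B :: "'v \<Rightarrow> 'v \<Rightarrow> 'a" and sing :: "'v \<Rightarrow> bool" +
  fixes D :: nat
  assumes max_iso_dim: "max_iso y \<Longrightarrow> dim y = D"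
    and D_pos: "D \<ge> 1"
    and hyperbolic: "sing a \<Longrightarrow> B u a \<noteq> 0 \<Longrightarrow> \<exists>b. sing (u + b *s a)"
begin

lemma max_iso_iff: "max_iso y \<longleftrightarrow> tot_iso y \<and> dim y = D"
proof
  assume "max_iso y"
  then show "tot_iso y \<and> dim y = D" by (simp add: max_iso_dim max_iso_tot_iso)
next
  assume y: "tot_iso y \<and> dim y = D"
  then obtain z where z: "max_iso z" "y \<subseteq> z" using max_iso_extend by blast
  then have "y = z"
    using y by (intro subspace_dim_equal) (auto simp: max_iso_dim max_iso_subspace tot_iso_subspace)
  then show "max_iso y" using z by simp
qed

lemma tot_iso_dim_le_D: "tot_iso W \<Longrightarrow> dim W \<le> D"
  by (metis dim_subset max_iso_dim max_iso_extend)

section \<open>Extending a subspace by one vector\<close>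

lemma dim_span_insert:
  "subspace H \<Longrightarrow> s \<notin> H \<Longrightarrow> dim (span (insert s H)) = dim H + 1"
  by (simp add: dim_insert span_eq_iff[THEN iffD2])

lemma in_span_insert_iff:
  "subspace H \<Longrightarrow> u \<in> span (insert s H) \<longleftrightarrow> (\<exists>k. u - k *s s \<in> H)"
  by (simp add: span_breakdown_eq span_eq_iff[THEN iffD2])

lemma subset_span_insert: "H \<subseteq> span (insert s H)" "s \<in> span (insert s H)"
  by (auto intro: span_base)

lemma scale_in_subspace_cancel:
  "subspace y \<Longrightarrow> k *s s \<in> y \<Longrightarrow> k \<noteq> 0 \<Longrightarrow> s \<in> y"
  using subspace_scale[of y "k *s s" "inverse k"] by simp

lemma Int_span_insert:
  assumes "subspace y" "subspace H" "H \<subseteq> y" "s \<notin> y"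
  shows "y \<inter> span (insert s H) = H"
proof
  show "y \<inter> span (insert s H) \<subseteq> H"
  proof
    fix u assume u: "u \<in> y \<inter> span (insert s H)"
    then obtain k where k: "u - k *s s \<in> H" using assms in_span_insert_iff by blast
    have "k *s s = u - (u - k *s s)" by simp
    then have "k *s s \<in> y" using u k assms subspace_diff by (metis Int_iff subsetD)
    then have "k = 0" using assms scale_in_subspace_cancel by blast
    then show "u \<in> H" using k by simp
  qed
  show "H \<subseteq> y \<inter> span (insert s H)" using assms subset_span_insert by blast
qed

text \<open>For a singular \<open>v\<close> outside a vertex \<open>y\<close> this is the only
  neighbour of \<open>y\<close> that contains \<open>v\<close>.\<close>

definition swap :: "'v set \<Rightarrow> 'v \<Rightarrow> 'v set" where
  "swap y v = span (insert v (y \<inter> orth {v}))"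

lemma swap:
  assumes y: "max_iso y" and v: "sing v" "v \<notin> y"
  shows "max_iso (swap y v)" "dim (y \<inter> orth {v}) = D - 1" "y \<inter> swap y v = y \<inter> orth {v}"
proof -
  let ?H = "y \<inter> orth {v}"
  have sy: "subspace y" using y max_iso_subspace by blast
  have sH: "subspace ?H" using sy by (simp add: subspace_Int_orth)
  have tH: "tot_iso ?H" using y sH by (meson Int_lower1 max_iso_tot_iso tot_iso_subset)
  have "v \<in> orth ?H" using B_commute_0 by (auto simp: orth_def)
  then have t: "tot_iso (swap y v)" unfolding swap_def using tH v tot_iso_insert by blast
  have d: "dim (swap y v) = dim ?H + 1" unfolding swap_def using v by (intro dim_span_insert[OF sH]) blast
  have "D \<le> dim ?H + 1" using dim_Int_orth_singleton[OF sy, of v] y max_iso_dim by simp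
  moreover have "dim ?H + 1 \<le> D" using tot_iso_dim_le_D[OF t] d by simp
  ultimately show "max_iso (swap y v)" "dim ?H = D - 1"
    using t d by (auto simp: max_iso_iff)
  show "y \<inter> swap y v = ?H" unfolding swap_def using sy sH v by (simp add: Int_span_insert)
qed

definition edges :: "('v set \<times> 'v set) set" where
  "edges = {(y, z). max_iso y \<and> max_iso z \<and> dim (y \<inter> z) = D - 1}"

lemma hyperplane_span_insert:
  assumes "max_iso y" "subspace H" "H \<subseteq> y" "dim H = D - 1" "a \<in> y" "a \<notin> H"
  shows "y = span (insert a H)"
proof -
  have "span (insert a H) = y"
  proof (rule subspace_dim_equal)
    show "span (insert a H) \<subseteq> y" using assms by (intro span_minimal) (auto simp: max_iso_subspace)
    show "dim y \<le> dim (span (insert a H))"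
      using assms by (simp add: dim_span_insert max_iso_dim del: dim_span)
  qed (use assms in \<open>auto simp: max_iso_subspace\<close>)
  then show ?thesis by simp
qed

text \<open>A vector of \<open>x \<inter> z\<close> is orthogonal to \<open>a\<close>, both being in
  \<open>x\<close>, and to \<open>y \<inter> z\<close>, both being in \<open>z\<close>. These span
  \<open>y\<close>, so by maximality the vector lies in \<open>y\<close>.\<close>

lemma edges_Int_subset:
  assumes x: "max_iso x" and e: "(y, z) \<in> edges" and a: "a \<in> x" "a \<in> y" "a \<notin> z"
  shows "x \<inter> z \<subseteq> y"
proof
  fix b assume b: "b \<in> x \<inter> z"
  have y: "max_iso y" and z: "max_iso z" and d: "dim (y \<inter> z) = D - 1"
    using e by (auto simp: edges_def)
  have "y = span (insert a (y \<inter> z))"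
    using y z d a by (intro hyperplane_span_insert) (auto simp: subspace_inter max_iso_subspace)
  moreover have "b \<in> orth (insert a (y \<inter> z))"
    using a b x z tot_iso_B max_iso_tot_iso by (auto simp: orth_def)
  ultimately have "b \<in> orth y" using orth_span by metis
  moreover have "sing b" using b x max_iso_tot_iso tot_iso_sing by blast
  ultimately show "b \<in> y" using y max_iso_absorb by blast
qed

lemma edges_Int_eq:
  assumes x: "max_iso x" and e: "(y, z) \<in> edges" and d: "dim (x \<inter> y) = dim (x \<inter> z)"
  shows "x \<inter> y = x \<inter> z"
proof (cases "x \<inter> y \<subseteq> z")
  case True
  then show ?thesis
    using e d x by (intro subspace_dim_equal) (auto simp: edges_def max_iso_subspace subspace_inter)
next
  case False
  then obtain a where "a \<in> x" "a \<in> y" "a \<notin> z" by blast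
  then have "x \<inter> z \<subseteq> x \<inter> y" using x e edges_Int_subset by blast
  then have "x \<inter> z = x \<inter> y"
    using e d x by (intro subspace_dim_equal) (auto simp: edges_def max_iso_subspace subspace_inter)
  then show ?thesis by simp
qed

subsection \<open>Distance\<close>

text \<open>One step in the graph changes the intersection with \<open>x\<close> by at most one
  dimension, which bounds the distance from below.\<close>

lemma edges_dim_Int:
  assumes x: "max_iso x" and e: "(y, z) \<in> edges"
  shows "dim (x \<inter> y) \<le> dim (x \<inter> z) + 1"
proof (cases "x \<inter> y \<subseteq> z")
  case True
  then show ?thesis using dim_subset[of "x \<inter> y" "x \<inter> z"] by auto
next
  case False
  then obtain a where a: "a \<in> x" "a \<in> y" "a \<notin> z" by blast
  have y: "max_iso y" and z: "max_iso z" and d: "dim (y \<inter> z) = D - 1"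
    using e by (auto simp: edges_def)
  have s: "subspace (y \<inter> z)" "subspace (x \<inter> z)" "subspace x"
    using x y z by (auto simp: max_iso_subspace subspace_inter)
  have eq: "y = span (insert a (y \<inter> z))"
    using y z d a by (intro hyperplane_span_insert) (auto simp: subspace_inter max_iso_subspace)
  have "x \<inter> y \<subseteq> span (insert a (x \<inter> z))"
  proof
    fix u assume u: "u \<in> x \<inter> y"
    then obtain k where k: "u - k *s a \<in> y \<inter> z" using eq s in_span_insert_iff by blast
    moreover have "u - k *s a \<in> x" using u a s by (simp add: subspace_diff subspace_scale)
    ultimately show "u \<in> span (insert a (x \<inter> z))" using s in_span_insert_iff by blast
  qed
  then have "dim (x \<inter> y) \<le> dim (insert a (x \<inter> z))" by (rule dim_mono)
  then show ?thesis by (auto simp: dim_insert split: if_splits)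
qed

lemma relpow_edges_dim:
  assumes x: "max_iso x"
  shows "(x, y) \<in> edges ^^ k \<Longrightarrow> D \<le> dim (x \<inter> y) + k"
proof (induction k arbitrary: y)
  case 0
  then show ?case using x by (simp add: max_iso_dim)
next
  case (Suc k)
  then obtain z where "(x, z) \<in> edges ^^ k" "(z, y) \<in> edges" by auto
  then show ?case using Suc.IH[of z] edges_dim_Int[OF x, of z y] by simp
qed

text \<open>Swapping in a vector \<open>v\<close> of \<open>x - y\<close> keeps
  \<open>x \<inter> y\<close>, which is orthogonal to \<open>v\<close>, and adds \<open>v\<close>;
  this neighbour of \<open>y\<close> is one step closer to \<open>x\<close>.\<close>

lemma relpow_edges_ex:
  assumes x: "max_iso x"
  shows "max_iso y \<Longrightarrow> dim (x \<inter> y) + k = D \<Longrightarrow> (x, y) \<in> edges ^^ k"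
proof (induction k arbitrary: y)
  case 0
  have "x \<inter> y = x"
    by (rule subspace_dim_equal) (use 0 x in \<open>auto simp: max_iso_dim max_iso_subspace subspace_inter\<close>)
  moreover have "x \<inter> y = y"
    by (rule subspace_dim_equal) (use 0 x in \<open>auto simp: max_iso_dim max_iso_subspace subspace_inter\<close>)
  ultimately show ?case by simp
next
  case (Suc k)
  have "\<not> x \<subseteq> y"
  proof
    assume "x \<subseteq> y"
    then have "x \<inter> y = x" by blast
    then show False using Suc.prems x by (simp add: max_iso_dim)
  qed
  then obtain v where v: "v \<in> x" "v \<notin> y" by blast
  have sv: "sing v" using v x max_iso_tot_iso tot_iso_sing by blast
  let ?z = "swap y v"
  note sw = swap[OF Suc.prems(1) sv v(2)]
  have zy: "(?z, y) \<in> edges"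
    using sw Suc.prems by (simp add: edges_def Int_commute)
  have "v \<in> ?z" unfolding swap_def by (rule subset_span_insert)
  have "x \<inter> y \<subseteq> orth {v}" using v x max_iso_tot_iso tot_iso_B by (auto simp: orth_def)
  then have "insert v (x \<inter> y) \<subseteq> x \<inter> ?z" using sw v \<open>v \<in> ?z\<close> by blast
  then have "dim (insert v (x \<inter> y)) \<le> dim (x \<inter> ?z)" by (rule dim_subset)
  moreover have "subspace (x \<inter> y)" using x Suc.prems by (simp add: max_iso_subspace subspace_inter)
  ultimately have "dim (x \<inter> y) + 1 \<le> dim (x \<inter> ?z)"
    using v by (simp add: dim_insert span_eq_iff[THEN iffD2])
  moreover have "dim (x \<inter> ?z) \<le> dim (x \<inter> y) + 1" using edges_dim_Int[OF x zy] .
  ultimately have "(x, ?z) \<in> edges ^^ k" using Suc sw by simp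
  then show ?case using zy by auto
qed

lemma graph_dist_edges:
  assumes x: "max_iso x" and y: "max_iso y"
  shows "graph_dist edges x y = D - dim (x \<inter> y)"
  unfolding graph_dist_def
proof (rule Least_equality)
  have "dim (x \<inter> y) \<le> D"
    using x by (metis Int_lower1 dim_subset max_iso_dim)
  then show "(x, y) \<in> edges ^^ (D - dim (x \<inter> y))"
    using x y by (simp add: relpow_edges_ex)
next
  fix k assume "(x, y) \<in> edges ^^ k"
  then show "D - dim (x \<inter> y) \<le> k" using relpow_edges_dim[OF x] by fastforce
qed

subsection \<open>Maximal subspaces with prescribed intersection\<close>

text \<open>The vertices summed over in \<open>eta_N\<close>, hence the candidates for the
  equivalence classes. For \<open>\<eta> = {0}\<close> they are the vertices at distance
  \<open>D\<close> from \<open>x\<close>.\<close>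

definition opposite :: "'v set \<Rightarrow> 'v set \<Rightarrow> 'v set set" where
  "opposite x \<eta> = {y. max_iso y \<and> x \<inter> y = \<eta>}"

text \<open>Extend a basis of \<open>L\<close> by \<open>a\<close>, then to a basis of
  \<open>y\<close>, and drop \<open>a\<close>.\<close>

lemma hyperplane_avoiding:
  assumes y: "max_iso y" and L: "subspace L" "L \<subseteq> y" and a: "a \<in> y" "a \<notin> L"
  obtains H where "subspace H" "L \<subseteq> H" "H \<subseteq> y" "a \<notin> H" "dim H = D - 1"
proof -
  obtain C where C: "C \<subseteq> L" "independent C" "L \<subseteq> span C"
    using basis_exists by metis
  have sC: "span C = L" using C L span_minimal by blast
  have "independent (insert a C)" using C sC a by (simp add: independent_insertI)
  moreover have "insert a C \<subseteq> y" using C L a by blast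
  ultimately obtain F where F: "insert a C \<subseteq> F" "F \<subseteq> y" "independent F" "y \<subseteq> span F"
    using maximal_independent_subset_extend[of "insert a C" y] by auto
  have cF: "card F = D" using basis_card_eq_dim[of F y] F max_iso_dim[OF y] by simp
  have i: "independent (F - {a})" using F by (meson Diff_subset independent_mono)
  have aC: "a \<notin> C" using a C by blast
  show thesis
  proof
    show "subspace (span (F - {a}))" by simp
    show "L \<subseteq> span (F - {a})" unfolding sC[symmetric] using F aC by (intro span_mono) blast
    show "span (F - {a}) \<subseteq> y"
      using F y by (intro span_minimal) (auto simp: max_iso_subspace)
    show "a \<notin> span (F - {a})" using F unfolding dependent_def by blast
    show "dim (span (F - {a})) = D - 1"
      using dim_span_eq_card_independent[OF i] cF F by simp
  qed
qed

text \<open>Among the vertices over \<open>L\<close> take one with the smallest intersection with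
  \<open>x\<close>. If it met \<open>x\<close> in some \<open>a\<close> outside \<open>L\<close>,
  one could exchange \<open>a\<close> for another singular vector over a hyperplane \<open>H\<close>
  containing \<open>L\<close> and shrink the intersection. With \<open>L = \<eta>\<close> this shows
  that no class is empty.\<close>

lemma opposite_nonempty:
  assumes L: "tot_iso L" and x: "max_iso x"
  obtains y where "max_iso y" "L \<subseteq> y" "x \<inter> y = x \<inter> L"
proof -
  obtain y0 where "max_iso y0 \<and> L \<subseteq> y0" using L max_iso_extend by blast
  from ex_has_least_nat[of "\<lambda>y. max_iso y \<and> L \<subseteq> y", OF this, of "\<lambda>y. dim (x \<inter> y)"]
  obtain y where y: "max_iso y" "L \<subseteq> y"
    and min: "\<And>z. max_iso z \<Longrightarrow> L \<subseteq> z \<Longrightarrow> dim (x \<inter> y) \<le> dim (x \<inter> z)" by blast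
  have "x \<inter> y \<subseteq> L"
  proof (rule ccontr)
    assume "\<not> x \<inter> y \<subseteq> L"
    then obtain a where a: "a \<in> x" "a \<in> y" "a \<notin> L" by blast
    obtain H where H: "subspace H" "L \<subseteq> H" "H \<subseteq> y" "a \<notin> H" "dim H = D - 1"
      using hyperplane_avoiding[OF y(1) tot_iso_subspace[OF L] y(2) a(2,3)] by blast
    have ty: "tot_iso y" using y max_iso_tot_iso by blast
    have tH: "tot_iso H" using H ty tot_iso_subset by blast
    have yH: "y = span (insert a H)" using y H a by (intro hyperplane_span_insert) auto
    \<comment> \<open>\<open>orth H\<close> is one dimension larger than \<open>orth y\<close>, so
      some vector is orthogonal to \<open>H\<close> but not to \<open>a\<close>; adding a multiple
      of \<open>a\<close> makes it singular.\<close>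
    have "\<not> orth H \<subseteq> orth {a}"
    proof
      assume "orth H \<subseteq> orth {a}"
      then have "orth H \<subseteq> orth (insert a H)" by (auto simp: orth_def)
      then have "dim (orth H) \<le> dim (orth y)" using yH orth_span dim_subset by metis
      then show False
        using dim_orth_tot_iso[OF tH] dim_orth_tot_iso[OF ty] H max_iso_dim[OF y(1)] D_pos by linarith
    qed
    then obtain u where u: "u \<in> orth H" "B u a \<noteq> 0" by (auto simp: orth_def)
    have sa: "sing a" using a ty tot_iso_sing by blast
    then obtain b where b: "sing (u + b *s a)" using hyperbolic u by blast
    define s where "s = u + b *s a"
    have "a \<in> orth H" using a H ty tot_iso_B by (auto simp: orth_def)
    then have sH: "s \<in> orth H"
      unfolding s_def using u by (intro subspace_add subspace_scale subspace_orth)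
    have "B s a \<noteq> 0" unfolding s_def using u B_self[OF sa] by (simp add: B_add_left B_scale_left)
    then have sy: "s \<notin> y" using a ty tot_iso_B by blast
    define z where "z = span (insert s H)"
    have tz: "tot_iso z" unfolding z_def using tH b sH s_def tot_iso_insert by blast
    have "dim z = D"
      unfolding z_def using H sy D_pos by (subst dim_span_insert) auto
    then have z: "max_iso z" using tz max_iso_iff by blast
    have yz: "y \<inter> z = H"
      unfolding z_def using y H sy by (intro Int_span_insert) (auto simp: max_iso_subspace)
    then have "(y, z) \<in> edges" using y z H by (simp add: edges_def)
    \<comment> \<open>Since \<open>a\<close> lies in \<open>x\<close> and \<open>y\<close> but not
      in \<open>z\<close>, passing to \<open>z\<close> only loses vectors of \<open>x\<close>;
      minimality forbids the loss of \<open>a\<close>.\<close>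
    then have "x \<inter> z \<subseteq> y" using x a H yz by (intro edges_Int_subset) auto
    then have xz: "x \<inter> z \<subseteq> x \<inter> y" by blast
    have "L \<subseteq> z" using H yz by blast
    then have "dim (x \<inter> y) \<le> dim (x \<inter> z)" using min z by blast
    then have "x \<inter> z = x \<inter> y"
      using x y z xz by (intro subspace_dim_equal) (auto simp: max_iso_subspace subspace_inter)
    then show False using a H yz by blast
  qed
  then have "x \<inter> y = x \<inter> L" using y by blast
  then show thesis using that y by blast
qed

end

subsection \<open>Connectivity\<close>

context dual_polar
begin

text \<open>The members through \<open>v\<close> form a set of the same kind in which
  \<open>\<eta>\<close> has grown by \<open>v\<close>. The induction in
  \<open>opposite_connected\<close> descends along this.\<close>

lemma opposite_swap:
  assumes x: "max_iso x" and v: "sing v" "v \<notin> x" and \<eta>: "subspace \<eta>" "\<eta> \<subseteq> x"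
  shows "opposite (swap x v) (span (insert v \<eta>)) = {w \<in> opposite x \<eta>. v \<in> w}"
proof (intro set_eqI iffI)
  fix w assume "w \<in> opposite (swap x v) (span (insert v \<eta>))"
  then have w: "max_iso w" and eq: "swap x v \<inter> w = span (insert v \<eta>)"
    by (auto simp: opposite_def)
  have vw: "v \<in> w" and \<eta>w: "\<eta> \<subseteq> w" using eq subset_span_insert by blast+
  have "x \<inter> w \<subseteq> \<eta>"
  proof
    fix u assume u: "u \<in> x \<inter> w"
    then have "u \<in> orth {v}" using vw w max_iso_tot_iso tot_iso_B by (auto simp: orth_def)
    then have "u \<in> swap x v" unfolding swap_def using u by (intro span_base) blast
    then have "u \<in> x \<inter> span (insert v \<eta>)" using u eq by blast
    then show "u \<in> \<eta>" using Int_span_insert[of x \<eta> v] x \<eta> v max_iso_subspace by blast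
  qed
  then show "w \<in> {w \<in> opposite x \<eta>. v \<in> w}" using vw \<eta>w \<eta> w by (auto simp: opposite_def)
next
  fix w assume "w \<in> {w \<in> opposite x \<eta>. v \<in> w}"
  then have w: "max_iso w" "v \<in> w" and eq: "x \<inter> w = \<eta>" by (auto simp: opposite_def)
  have sw: "subspace w" using w max_iso_subspace by blast
  have "swap x v \<inter> w \<subseteq> span (insert v \<eta>)"
  proof
    fix u assume u: "u \<in> swap x v \<inter> w"
    then obtain k where k: "u - k *s v \<in> x \<inter> orth {v}"
      unfolding swap_def using in_span_insert_iff x max_iso_subspace subspace_Int_orth by blast
    have "u - k *s v \<in> w" using u w sw by (simp add: subspace_diff subspace_scale)
    then have "u - k *s v \<in> \<eta>" using k eq by blast
    then show "u \<in> span (insert v \<eta>)" using \<eta> in_span_insert_iff by blast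
  qed
  moreover have "span (insert v \<eta>) \<subseteq> w" using w eq sw by (intro span_minimal) auto
  moreover have "span (insert v \<eta>) \<subseteq> swap x v"
  proof -
    have "\<eta> \<subseteq> orth {v}" using w eq max_iso_tot_iso tot_iso_B by (auto simp: orth_def)
    then show ?thesis unfolding swap_def using \<eta> by (intro span_mono) blast
  qed
  ultimately show "w \<in> opposite (swap x v) (span (insert v \<eta>))"
    using w by (auto simp: opposite_def)
qed

text \<open>The condition under which some \<open>m \<in> opposite x \<eta>\<close> meets both \<open>y\<close> and \<open>z\<close> outside \<open>\<eta>\<close>.\<close>

definition linked :: "'v set \<Rightarrow> 'v set \<Rightarrow> 'v set \<Rightarrow> bool" where
  "linked x y z \<longleftrightarrow> (\<exists>v\<in>y - x. \<exists>w\<in>z. B w v = 0 \<and> (\<forall>c. w - c *s v \<notin> x))"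

text \<open>\<open>linked\<close> makes \<open>v\<close> and \<open>w\<close> independent modulo
  \<open>x\<close>, so \<open>opposite_nonempty\<close> applies to the span of
  \<open>\<eta>\<close>, \<open>v\<close> and \<open>w\<close>.\<close>

lemma linked_obtain:
  assumes x: "max_iso x" and y: "y \<in> opposite x \<eta>" and z: "z \<in> opposite x \<eta>" and l: "linked x y z"
  obtains m v w where "m \<in> opposite x \<eta>" "v \<in> y \<inter> m" "v \<notin> \<eta>" "w \<in> m \<inter> z" "w \<notin> \<eta>"
proof -
  obtain v w where v: "v \<in> y" "v \<notin> x" and w: "w \<in> z" "B w v = 0" and c: "\<And>c. w - c *s v \<notin> x"
    using l unfolding linked_def by blast
  have wx: "w \<notin> x" using c[of 0] by simp
  have my: "max_iso y" "x \<inter> y = \<eta>" and mz: "max_iso z" "x \<inter> z = \<eta>"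
    using y z by (auto simp: opposite_def)
  have ty: "tot_iso y" and tz: "tot_iso z" using my mz max_iso_tot_iso by auto
  have sx: "subspace x" using x max_iso_subspace by blast
  have s\<eta>: "subspace \<eta>" using my sx max_iso_subspace subspace_inter by metis
  define K where "K = span (insert v \<eta>)"
  have Ky: "K \<subseteq> y" unfolding K_def using my v by (intro span_minimal) (auto simp: max_iso_subspace)
  have sK: "subspace K" by (simp add: K_def)
  have tK: "tot_iso K" using Ky sK ty tot_iso_subset by blast
  have "w \<in> orth (insert v \<eta>)" using w mz tz tot_iso_B by (auto simp: orth_def)
  then have "w \<in> orth K" by (simp add: K_def orth_span)
  then have tL: "tot_iso (span (insert w K))"
    using tK tz w tot_iso_sing tot_iso_insert by blast
  have xL: "x \<inter> span (insert w K) \<subseteq> \<eta>"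
  proof
    fix u assume u: "u \<in> x \<inter> span (insert w K)"
    then obtain k where k: "u - k *s w \<in> K" using sK in_span_insert_iff by blast
    \<comment> \<open>A nonzero coefficient of \<open>w\<close> would, after division by it, put
      some \<open>w - c *s v\<close> into \<open>x\<close>.\<close>
    have "k = 0"
    proof (rule ccontr)
      assume k0: "k \<noteq> 0"
      obtain j where "u - k *s w - j *s v \<in> \<eta>" using k s\<eta> in_span_insert_iff K_def by blast
      then have "u - k *s w - j *s v \<in> x" using my by blast
      then have "u - (u - k *s w - j *s v) \<in> x" using u sx subspace_diff by blast
      then have "k *s w + j *s v \<in> x" by (simp add: algebra_simps)
      then have "inverse k *s (k *s w + j *s v) \<in> x" using sx subspace_scale by blast
      then have "w - (- (j / k)) *s v \<in> x"
        using k0 by (simp add: scale_right_distrib divide_inverse mult.commute)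
      then show False using c by blast
    qed
    then have "u \<in> K" using k by simp
    then show "u \<in> \<eta>" using u Ky my by blast
  qed
  obtain m where m: "max_iso m" "span (insert w K) \<subseteq> m" "x \<inter> m = x \<inter> span (insert w K)"
    using opposite_nonempty[OF tL x] by blast
  have Km: "K \<subseteq> m" "w \<in> m" using m subset_span_insert by blast+
  have "\<eta> \<subseteq> K" "v \<in> K" unfolding K_def by (rule subset_span_insert)+
  then have "x \<inter> m = \<eta>" using m xL my Km by blast
  then have "m \<in> opposite x \<eta>" using m by (simp add: opposite_def)
  then show thesis using that[of m v w] v w wx my mz Km \<open>v \<in> K\<close> by blast
qed

text \<open>For \<open>z \<in> opposite x \<eta>\<close> this says that \<open>z\<close> is the graph of a map \<open>y \<rightarrow> x / \<eta>\<close> whose associated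
  form on \<open>y\<close> is alternating.\<close>

definition alternating_graph :: "'v set \<Rightarrow> 'v set \<Rightarrow> 'v set \<Rightarrow> bool" where
  "alternating_graph x y z \<longleftrightarrow> (\<forall>v\<in>y. \<exists>a\<in>x. v + a \<in> z \<and> B a v = 0)"

text \<open>Without a link, every \<open>w\<close> in \<open>z\<close> orthogonal to some
  \<open>v\<close> in \<open>y - \<eta>\<close> is a multiple of \<open>v\<close> modulo
  \<open>x\<close>. Dimension provides such a \<open>w\<close> outside \<open>\<eta>\<close>, and
  rescaling it to \<open>v + a\<close> gives the required \<open>a\<close>.\<close>

lemma not_linked:
  assumes x: "max_iso x" and y: "y \<in> opposite x \<eta>" and z: "z \<in> opposite x \<eta>"
    and d: "dim \<eta> + 2 \<le> D" and l: "\<not> linked x y z"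
  shows "alternating_graph x y z" "dim \<eta> + 2 = D"
proof -
  have my: "max_iso y" "x \<inter> y = \<eta>" and mz: "max_iso z" "x \<inter> z = \<eta>"
    using y z by (auto simp: opposite_def)
  have sx: "subspace x" and sy: "subspace y" and sz: "subspace z"
    using x my mz max_iso_subspace by auto
  have s\<eta>: "subspace \<eta>" using my sx sy subspace_inter by metis
  have stuck: "\<exists>c. w - c *s v \<in> x" if "v \<in> y" "v \<notin> \<eta>" "w \<in> z" "B w v = 0" for v w
    using l that my unfolding linked_def by blast
  have ex: "\<exists>w\<in>z. w \<notin> \<eta> \<and> B w v = 0" for v
  proof (rule ccontr)
    assume "\<not> ?thesis"
    then have "z \<inter> orth {v} \<subseteq> \<eta>" by (auto simp: orth_def)
    then have "dim (z \<inter> orth {v}) \<le> dim \<eta>" by (rule dim_subset)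
    then show False using dim_Int_orth_singleton[OF sz, of v] max_iso_dim[OF mz(1)] d by simp
  qed
  show "alternating_graph x y z"
    unfolding alternating_graph_def
  proof
    fix v assume v: "v \<in> y"
    show "\<exists>a\<in>x. v + a \<in> z \<and> B a v = 0"
    proof (cases "v \<in> \<eta>")
      case True
      then show ?thesis using mz sx by (intro bexI[of _ 0]) (auto simp: subspace_0)
    next
      case False
      obtain w where w: "w \<in> z" "w \<notin> \<eta>" "B w v = 0" using ex by blast
      obtain c where c: "w - c *s v \<in> x" using stuck[OF v False w(1,3)] by blast
      have c0: "c \<noteq> 0" using c w mz by auto
      define a where "a = inverse c *s (w - c *s v)"
      have "a \<in> x" unfolding a_def using c sx subspace_scale by blast
      moreover have "v + a = inverse c *s w" using c0 by (simp add: a_def scale_right_diff_distrib)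
      then have "v + a \<in> z" using w sz subspace_scale by simp
      moreover have "B v v = 0" using my v max_iso_tot_iso tot_iso_B by blast
      then have "B a v = 0" unfolding a_def using w by (simp add: B_scale_left B_diff_left)
      ultimately show ?thesis by blast
    qed
  qed
  have "\<not> y \<subseteq> \<eta>"
    using dim_subset[of y \<eta>] max_iso_dim[OF my(1)] d by auto
  then obtain v where v: "v \<in> y" "v \<notin> \<eta>" by blast
  obtain w where w: "w \<in> z" "w \<notin> \<eta>" "B w v = 0" using ex by blast
  obtain c where c: "w - c *s v \<in> x" using stuck[OF v w(1,3)] by blast
  have c0: "c \<noteq> 0" using c w mz by auto
  \<comment> \<open>Vectors of \<open>z\<close> that are multiples of the same \<open>v\<close>
    modulo \<open>x\<close> add at most one dimension to \<open>\<eta>\<close>, whereas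
    \<open>z \<inter> orth {v}\<close> has dimension at least \<open>D - 1\<close>.\<close>
  have "z \<inter> orth {v} \<subseteq> span (insert w \<eta>)"
  proof
    fix u assume u: "u \<in> z \<inter> orth {v}"
    then obtain k where k: "u - k *s v \<in> x" using stuck[OF v, of u] by (auto simp: orth_def)
    have "u - (k / c) *s w = (u - k *s v) - (k / c) *s (w - c *s v)"
      using c0 by (simp add: scale_right_diff_distrib)
    moreover have "(u - k *s v) - (k / c) *s (w - c *s v) \<in> x"
      using subspace_diff[OF sx k subspace_scale[OF sx c]] .
    ultimately have "u - (k / c) *s w \<in> x" by (simp only:)
    moreover have "u - (k / c) *s w \<in> z" using u w sz by (simp add: subspace_diff subspace_scale)
    ultimately have "u - (k / c) *s w \<in> \<eta>" using mz by blast
    then show "u \<in> span (insert w \<eta>)" using s\<eta> in_span_insert_iff by blast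
  qed
  then have "dim (z \<inter> orth {v}) \<le> dim (insert w \<eta>)" by (rule dim_mono)
  also have "\<dots> \<le> dim \<eta> + 1" by (simp add: dim_insert)
  finally show "dim \<eta> + 2 = D"
    using dim_Int_orth_singleton[OF sz, of v] max_iso_dim[OF mz(1)] d by simp
qed

end

text \<open>The first alternative is the one that holds for quadratic forms, the second one for sesquilinear
  forms. For a quadratic form, \<open>e + c *s a\<close> is singular only if \<open>c = 0\<close>; there the first alternative
  is what excludes type \<open>D\<close>.\<close>

locale nonbipartite_dual_polar = dual_polar +
  assumes nonbipartite: "2 * D < dim (UNIV :: 'b set) \<or>
    (\<forall>a e. sing a \<longrightarrow> sing e \<longrightarrow> B a e \<noteq> 0 \<longrightarrow> (\<exists>c. c \<noteq> 0 \<and> sing (e + scale c a)))"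
begin

text \<open>The new vertex keeps the hyperplane \<open>K\<close> of \<open>y\<close> spanned by
  \<open>\<eta>\<close> and \<open>v\<close>; the remaining direction \<open>e\<close> is replaced
  by a suitable singular \<open>s\<close> orthogonal to \<open>K\<close>.\<close>

lemma detour:
  assumes x: "max_iso x" and y: "y \<in> opposite x \<eta>" and z: "z \<in> opposite x \<eta>"
    and d: "dim \<eta> + 2 = D" and alt: "alternating_graph x y z"
  obtains y' v where "y' \<in> opposite x \<eta>" "v \<in> y \<inter> y'" "v \<notin> \<eta>" "\<not> alternating_graph x y' z"
proof -
  note result = that
  have my: "max_iso y" "x \<inter> y = \<eta>" and mz: "max_iso z" "x \<inter> z = \<eta>"
    using y z by (auto simp: opposite_def)
  have sx: "subspace x" and sy: "subspace y" and sz: "subspace z"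
    using x my mz max_iso_subspace by auto
  have tx: "tot_iso x" and ty: "tot_iso y" and tz: "tot_iso z"
    using x my mz max_iso_tot_iso by auto
  have s\<eta>: "subspace \<eta>" using my sx sy subspace_inter by metis
  have "\<not> y \<subseteq> \<eta>" using dim_subset[of y \<eta>] max_iso_dim[OF my(1)] d by auto
  then obtain v where v: "v \<in> y" "v \<notin> \<eta>" by blast
  then have vx: "v \<notin> x" using my by blast
  define K where "K = span (insert v \<eta>)"
  have sK: "subspace K" by (simp add: K_def)
  have \<eta>K: "\<eta> \<subseteq> K" and vK: "v \<in> K" unfolding K_def by (rule subset_span_insert)+
  have dK: "dim K = D - 1" unfolding K_def using dim_span_insert[OF s\<eta> v(2)] d by simp
  have Ky: "K \<subseteq> y" unfolding K_def using my v by (intro span_minimal) (auto simp: sy)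
  have tK: "tot_iso K" using Ky sK ty tot_iso_subset by blast
  have "\<not> y \<subseteq> K" using dim_subset[of y K] max_iso_dim[OF my(1)] d dK by auto
  then obtain e where e: "e \<in> y" "e \<notin> K" by blast
  have yK: "y = span (insert e K)" using my sK Ky dK e by (intro hyperplane_span_insert) auto
  have "\<not> x \<inter> orth {v} \<subseteq> \<eta>"
    using dim_subset[of "x \<inter> orth {v}" \<eta>] dim_Int_orth_singleton[OF sx, of v] max_iso_dim[OF x] d by auto
  \<comment> \<open>\<open>x \<inter> orth {v}\<close> has dimension at least \<open>D - 1\<close>,
    while \<open>\<eta>\<close> has dimension \<open>D - 2\<close>.\<close>
  then obtain a where a: "a \<in> x" "a \<notin> \<eta>" "B a v = 0" by (auto simp: orth_def)
  have "a \<in> orth (insert v \<eta>)" using a my tx tot_iso_B by (auto simp: orth_def)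
  then have aK: "a \<in> orth K" by (simp add: K_def orth_span)
  have eK: "e \<in> orth K" using e Ky ty tot_iso_B by (auto simp: orth_def)
  have sa: "sing a" and se: "sing e" using a e tx ty tot_iso_sing by auto
  have ae: "B a e \<noteq> 0"
  proof
    assume "B a e = 0"
    then have "a \<in> orth (insert e K)" using aK by (auto simp: orth_def)
    then have "a \<in> orth y" using yK orth_span by metis
    then have "a \<in> y" using my sa max_iso_absorb by blast
    then show False using a my by blast
  qed
  \<comment> \<open>It suffices to find \<open>s\<close> outside \<open>x + K\<close> such that no
    \<open>b\<close> in \<open>x\<close> with \<open>s + b\<close> in \<open>z\<close> is orthogonal
    to \<open>s\<close>.\<close>
  have new: thesis
    if s: "sing s" "s \<in> orth K" and out: "\<And>p q. p \<in> x \<Longrightarrow> q \<in> K \<Longrightarrow> s \<noteq> p + q"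
      and nalt: "\<And>b. b \<in> x \<Longrightarrow> s + b \<in> z \<Longrightarrow> B b s \<noteq> 0" for s
  proof -
    define y' where "y' = span (insert s K)"
    have sK': "s \<notin> K" using out[of 0 s] sx by (auto simp: subspace_0)
    have "tot_iso y'" unfolding y'_def using s tK tot_iso_insert by blast
    moreover have "dim y' = D" unfolding y'_def using dim_span_insert[OF sK sK'] dK d by simp
    ultimately have my': "max_iso y'" by (simp add: max_iso_iff)
    have "x \<inter> y' \<subseteq> \<eta>"
    proof
      fix u assume u: "u \<in> x \<inter> y'"
      then obtain k where k: "u - k *s s \<in> K" unfolding y'_def using sK in_span_insert_iff by blast
      have "k = 0"
      proof (rule ccontr)
        assume "k \<noteq> 0"
        then have "s = inverse k *s u + (- inverse k) *s (u - k *s s)"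
          by (simp add: scale_right_diff_distrib)
        moreover have "inverse k *s u \<in> x" using u sx subspace_scale by blast
        moreover have "(- inverse k) *s (u - k *s s) \<in> K" using k sK subspace_scale by blast
        ultimately show False using out by blast
      qed
      then show "u \<in> \<eta>" using u k Ky my by auto
    qed
    moreover have "K \<subseteq> y'" "s \<in> y'" unfolding y'_def by (rule subset_span_insert)+
    moreover have "\<eta> \<subseteq> x" using my by blast
    ultimately have "y' \<in> opposite x \<eta>" using my' \<eta>K by (auto simp: opposite_def)
    moreover have "\<not> alternating_graph x y' z"
      using nalt \<open>s \<in> y'\<close> unfolding alternating_graph_def by blast
    ultimately show thesis using result v vK \<open>K \<subseteq> y'\<close> by blast
  qed
  show thesis
    using nonbipartite
  proof
    assume "\<forall>a e. sing a \<longrightarrow> sing e \<longrightarrow> B a e \<noteq> 0 \<longrightarrow> (\<exists>c. c \<noteq> 0 \<and> sing (e + c *s a))"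
    then obtain c where c: "c \<noteq> 0" "sing (e + c *s a)" using sa se ae by blast
    show thesis
    proof (rule new)
      show "sing (e + c *s a)" by (rule c)
      show "e + c *s a \<in> orth K"
        using eK aK by (intro subspace_add subspace_scale subspace_orth)
      show "e + c *s a \<noteq> p + q" if "p \<in> x" "q \<in> K" for p q
      proof
        assume "e + c *s a = p + q"
        then have "e - q = p - c *s a" by (simp add: algebra_simps)
        moreover have "p - c *s a \<in> x" using that a sx by (simp add: subspace_diff subspace_scale)
        moreover have "e - q \<in> y" using that e Ky sy by (auto simp: subspace_diff)
        ultimately have "e - q \<in> \<eta>" using my by auto
        then have "e - q + q \<in> K" using that \<eta>K sK by (intro subspace_add) auto
        then show False using e by simp
      qed
      \<comment> \<open>The \<open>x\<close>-parts carrying \<open>s = e + c *s a\<close> and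
        \<open>e\<close> into \<open>z\<close> satisfy \<open>c *s a + b - a' \<in> \<eta>\<close>,
        and \<open>\<eta>\<close> is orthogonal to \<open>e\<close>. If \<open>b\<close> were
        orthogonal to \<open>s\<close>, then \<open>c * B a e\<close> would vanish.\<close>
      show "B b (e + c *s a) \<noteq> 0" if b: "b \<in> x" "e + c *s a + b \<in> z" for b
      proof
        assume "B b (e + c *s a) = 0"
        then have "B (e + c *s a) b = 0" by (rule B_reflexive)
        moreover have "B a b = 0" using a b tx tot_iso_B by blast
        ultimately have "B e b = 0" by (simp add: B_add_left B_scale_left)
        then have be: "B b e = 0" by (rule B_reflexive)
        obtain a' where a': "a' \<in> x" "e + a' \<in> z" "B a' e = 0"
          using alt e unfolding alternating_graph_def by blast
        have "(e + c *s a + b) - (e + a') \<in> z" using b a' sz subspace_diff by blast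
        moreover have "(e + c *s a + b) - (e + a') = c *s a + b - a'" by simp
        moreover have "c *s a + b - a' \<in> x"
          using a b a' sx by (simp add: subspace_diff subspace_add subspace_scale)
        ultimately have "c *s a + b - a' \<in> y" using my mz by auto
        then have "B (c *s a + b - a') e = 0" using e ty tot_iso_B by blast
        then show False using be a' c ae by (simp add: B_add_left B_diff_left B_scale_left)
      qed
    qed
  next
    assume big: "2 * D < dim (UNIV :: 'b set)"
    \<comment> \<open>By dimension \<open>x + z\<close> does not contain \<open>orth \<eta>\<close>,
      but by \<open>alt\<close> it contains \<open>y\<close>. An \<open>s\<close> outside
      \<open>x + z\<close> has no partner in \<open>z\<close> at all.\<close>
    let ?S = "{p + q |p q. p \<in> x \<and> q \<in> z}"
    have sS: "subspace ?S" using sx sz by (rule subspace_sums)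
    have "dim ?S + dim \<eta> = D + D"
      using dim_sums_Int[OF sx sz] mz max_iso_dim[OF x] max_iso_dim[OF mz(1)] by simp
    moreover have "dim (orth \<eta>) + dim \<eta> = dim (UNIV :: 'b set)"
      by (rule dim_orth_tot_iso) (metis inf_le1 my(2) s\<eta> tot_iso_subset tx)
    ultimately have "\<not> orth \<eta> \<subseteq> ?S"
      using dim_subset[of "orth \<eta>" ?S] big by linarith
    then obtain u where u: "u \<in> orth \<eta>" "u \<notin> ?S" by blast
    have xS: "p \<in> ?S" if "p \<in> x" for p
      using that subspace_0[OF sz] by force
    have yS: "q \<in> ?S" if q: "q \<in> y" for q
    proof -
      obtain b where b: "b \<in> x" "q + b \<in> z" using alt q unfolding alternating_graph_def by blast
      have "q = - b + (q + b)" by simp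
      moreover have "- b \<in> x" using b sx subspace_neg by blast
      ultimately show ?thesis using b by blast
    qed
    obtain b where b: "b \<in> x" "B b v \<noteq> 0"
    proof -
      have "v \<notin> orth x" using vx x v ty tot_iso_sing max_iso_absorb by blast
      then show thesis using that B_commute_0 by (auto simp: orth_def)
    qed
    \<comment> \<open>Subtracting a multiple of \<open>b\<close> in \<open>x\<close> achieves
      orthogonality to \<open>v\<close> without entering \<open>x + z\<close>.\<close>
    define u' where "u' = u - (B u v / B b v) *s b"
    have "B u' v = 0" using b by (simp add: u'_def B_diff_left B_scale_left)
    moreover have "u' \<in> orth \<eta>"
    proof -
      have "b \<in> orth \<eta>" using b my tx tot_iso_B by (auto simp: orth_def)
      then show ?thesis unfolding u'_def using u by (intro subspace_diff subspace_scale subspace_orth)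
    qed
    ultimately have "u' \<in> orth (insert v \<eta>)" by (auto simp: orth_def)
    then have u'K: "u' \<in> orth K" by (simp add: K_def orth_span)
    have u'S: "u' \<notin> ?S"
    proof
      assume "u' \<in> ?S"
      then have "u' + (B u v / B b v) *s b \<in> ?S"
        using sS xS b by (intro subspace_add subspace_scale) auto
      then show False using u by (simp add: u'_def)
    qed
    \<comment> \<open>Chosen so that \<open>u' + k *s e\<close> is not orthogonal to
      \<open>a\<close>, as \<open>hyperbolic\<close> requires.\<close>
    define k :: 'a where "k = (if B u' a = 0 then 1 else 0)"
    have "B e a \<noteq> 0" using ae B_commute_0 by blast
    then have "B (u' + k *s e) a \<noteq> 0" by (simp add: k_def B_add_left B_scale_left)
    then obtain j where j: "sing (u' + k *s e + j *s a)" using hyperbolic sa by blast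
    define s where "s = u' + k *s e + j *s a"
    have sS': "s \<notin> ?S"
    proof
      assume "s \<in> ?S"
      then have "s - j *s a - k *s e \<in> ?S"
        using sS xS yS a e by (intro subspace_diff subspace_scale) auto
      then show False using u'S by (simp add: s_def)
    qed
    show thesis
    proof (rule new)
      show "sing s" using j by (simp add: s_def)
      show "s \<in> orth K"
        unfolding s_def using u'K eK aK by (intro subspace_add subspace_scale subspace_orth)
      show "s \<noteq> p + q" if "p \<in> x" "q \<in> K" for p q
        using sS' that sS xS[of p] yS[of q] Ky subspace_add by blast
      show "B b s \<noteq> 0" if b: "b \<in> x" "s + b \<in> z" for b
      proof -
        have "s = - b + (s + b)" by simp
        moreover have "- b \<in> x" using b sx subspace_neg by blast
        ultimately have "s \<in> ?S" using b by blast
        then show ?thesis using sS' by blast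
      qed
    qed
  qed
qed

theorem opposite_connected:
  assumes "max_iso x" "y \<in> opposite x \<eta>" "z \<in> opposite x \<eta>"
  shows "(y, z) \<in> (Restr edges (opposite x \<eta>))\<^sup>*"
  using assms
proof (induction "D - dim \<eta>" arbitrary: x \<eta> y z rule: less_induct)
  case less
  note x = less.prems(1)
  have share: "(y, z) \<in> (Restr edges (opposite x \<eta>))\<^sup>*"
    if y: "y \<in> opposite x \<eta>" and z: "z \<in> opposite x \<eta>" and v: "v \<in> y \<inter> z" "v \<notin> \<eta>" for y z v
  proof -
    have my: "max_iso y" "x \<inter> y = \<eta>" using y by (auto simp: opposite_def)
    have s\<eta>: "subspace \<eta>" using my x max_iso_subspace subspace_inter by metis
    have sv: "sing v" using v my max_iso_tot_iso tot_iso_sing by blast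
    have vx: "v \<notin> x" using v my by blast
    let ?\<eta> = "span (insert v \<eta>)"
    have opp: "opposite (swap x v) ?\<eta> = {w \<in> opposite x \<eta>. v \<in> w}"
      using opposite_swap[OF x sv vx s\<eta>] my by blast
    have "?\<eta> \<subseteq> y" using my v by (intro span_minimal) (auto simp: max_iso_subspace)
    \<comment> \<open>This bound makes the truncated difference strictly smaller in the next
      line.\<close>
    then have "dim ?\<eta> \<le> D" using max_iso_dim[OF my(1)] dim_subset by metis
    then have "D - dim ?\<eta> < D - dim \<eta>" using dim_span_insert[OF s\<eta> v(2)] by simp
    then have "(y, z) \<in> (Restr edges (opposite (swap x v) ?\<eta>))\<^sup>*"
      using less.hyps[of ?\<eta> "swap x v" y z] swap(1)[OF x sv vx] y z v opp by blast
    moreover have "Restr edges (opposite (swap x v) ?\<eta>) \<subseteq> Restr edges (opposite x \<eta>)"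
      using opp by blast
    ultimately show ?thesis using rtrancl_mono by blast
  qed
  have link: "(y, z) \<in> (Restr edges (opposite x \<eta>))\<^sup>*"
    if y: "y \<in> opposite x \<eta>" and z: "z \<in> opposite x \<eta>" and l: "linked x y z" for y z
  proof -
    obtain m v w where m: "m \<in> opposite x \<eta>" "v \<in> y \<inter> m" "v \<notin> \<eta>" "w \<in> m \<inter> z" "w \<notin> \<eta>"
      using linked_obtain[OF x y z l] by blast
    then show ?thesis using share[OF y m(1-3)] share[OF m(1) z m(4,5)] by (rule_tac rtrancl_trans)
  qed
  note y = less.prems(2) and z = less.prems(3)
  have my: "max_iso y" "x \<inter> y = \<eta>" and mz: "max_iso z" "x \<inter> z = \<eta>"
    using y z by (auto simp: opposite_def)
  have sI: "subspace \<eta>" "subspace (y \<inter> z)" "subspace y" "subspace z"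
    using x my mz max_iso_subspace subspace_inter by metis+
  have sub: "\<eta> \<subseteq> y \<inter> z" using my mz by blast
  show ?case
  proof (cases "dim \<eta> + 2 \<le> D")
    case True
    show ?thesis
    proof (cases "linked x y z")
      case True
      then show ?thesis using link y z by blast
    next
      case False
      note nl = not_linked[OF x y z True False]
      \<comment> \<open>\<open>y'\<close> shares \<open>v\<close> with \<open>y\<close>, and it is
        linked to \<open>z\<close> because \<open>not_linked\<close> would otherwise make it
        alternating again.\<close>
      obtain y' v where y': "y' \<in> opposite x \<eta>" "v \<in> y \<inter> y'" "v \<notin> \<eta>" "\<not> alternating_graph x y' z"
        using detour[OF x y z nl(2,1)] by blast
      then have "linked x y' z" using not_linked[OF x y'(1) z True] by blast
      then show ?thesis
        using share[OF y y'(1-3)] link[OF y'(1) z] by (meson rtrancl_trans)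
    qed
  next
    \<comment> \<open>\<open>y \<inter> z\<close> contains \<open>\<eta>\<close>, so its dimension
      is at least \<open>D - 1\<close>: the vertices are adjacent or equal.\<close>
    case False
    show ?thesis
    proof (cases "dim (y \<inter> z) = D - 1")
      case True
      then have "(y, z) \<in> Restr edges (opposite x \<eta>)" using my mz y z by (simp add: edges_def)
      then show ?thesis by blast
    next
      case F2: False
      have "dim \<eta> \<le> dim (y \<inter> z)" using sub by (rule dim_subset)
      then have d: "D \<le> dim (y \<inter> z)" using False F2 by linarith
      have "y \<inter> z = y"
        by (rule subspace_dim_equal) (use sI d max_iso_dim[OF my(1)] in auto)
      moreover have "y \<inter> z = z"
        by (rule subspace_dim_equal) (use sI d max_iso_dim[OF mz(1)] in auto)
      ultimately show ?thesis by simp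
    qed
  qed
qed

end

section \<open>Finite fields\<close>

lemma card_le_card_fibres:
  assumes "finite A" "\<And>b. card {a\<in>A. f a = b} \<le> k"
  shows "card A \<le> k * card (f ` A)"
proof -
  have "A = (\<Union>b\<in>f ` A. {a\<in>A. f a = b})" by blast
  then have "card A \<le> (\<Sum>b\<in>f ` A. card {a\<in>A. f a = b})"
    using card_UN_le[of "f ` A" "\<lambda>b. {a\<in>A. f a = b}"] assms(1) by simp
  also have "\<dots> \<le> (\<Sum>b\<in>f ` A. k)" using assms(2) by (intro sum_mono)
  finally show ?thesis by (simp add: mult.commute)
qed

lemma card_roots_power_add_linear:
  fixes a c :: "'a::field"
  assumes "n \<ge> 2"
  shows "card {t. t ^ n + a * t = c} \<le> n"
proof -
  define P where "P = monom 1 n + [:- c, a:]"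
  have "degree [:- c, a:] < n" using assms by auto
  then have deg: "degree P = n" unfolding P_def by (subst degree_add_eq_left) (auto simp: degree_monom_eq)
  then have "P \<noteq> 0" using assms by auto
  moreover have "{t. t ^ n + a * t = c} = {t. poly P t = 0}"
    by (auto simp: P_def poly_monom algebra_simps eq_neg_iff_add_eq_0)
  ultimately show ?thesis using card_poly_roots_bound[of P] deg by simp
qed

lemma card_power_eq_le:
  fixes c :: "'a::{field,finite}"
  assumes "n \<ge> 1"
  shows "card {t. t ^ n = c} \<le> n"
proof (cases "n = 1")
  case True
  then show ?thesis by simp
next
  case False
  then show ?thesis using card_roots_power_add_linear[of n 0 c] assms by simp
qed

text \<open>Squaring is at most two to one on the nonzero elements, and 0 contributes one more
  square.\<close>

lemma card_squares:
  "CARD('a::{field,finite}) + 1 \<le> 2 * card (range (\<lambda>s::'a. s\<^sup>2))"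
proof -
  let ?U = "UNIV - {0::'a}" and ?f = "\<lambda>s::'a. s\<^sup>2"
  have "card {a\<in>?U. ?f a = b} \<le> 2" for b
    by (rule order_trans[OF card_mono card_power_eq_le[of 2 b]]) auto
  then have U: "card ?U \<le> 2 * card (?f ` ?U)" by (intro card_le_card_fibres) auto
  have "range ?f = insert 0 (?f ` ?U)" by auto
  moreover have "0 \<notin> ?f ` ?U" by auto
  ultimately have "card (range ?f) = card (?f ` ?U) + 1" by simp
  then show ?thesis using U by (simp add: card_Diff_singleton)
qed

text \<open>Pigeonhole: the values \<open>a * s\<^sup>2\<close> and \<open>c - b * t\<^sup>2\<close>
  each fill more than half of the field.\<close>

lemma weighted_sum_two_squares:
  fixes a b c :: "'a::{field,finite}"
  assumes "a \<noteq> 0" "b \<noteq> 0"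
  obtains s t where "a * s\<^sup>2 + b * t\<^sup>2 = c"
proof -
  let ?R = "range (\<lambda>s::'a. s\<^sup>2)"
  let ?X = "(\<lambda>s. a * s) ` ?R" and ?Y = "(\<lambda>t. c - b * t) ` ?R"
  have "?X \<inter> ?Y \<noteq> {}"
  proof
    assume "?X \<inter> ?Y = {}"
    then have "card ?X + card ?Y = card (?X \<union> ?Y)" by (simp add: card_Un_disjoint)
    also have "\<dots> \<le> CARD('a)" by (rule card_mono) auto
    finally have "card ?X + card ?Y \<le> CARD('a)" .
    moreover have "card ?X = card ?R" using assms by (intro card_image inj_onI) auto
    moreover have "card ?Y = card ?R" using assms by (intro card_image inj_onI) auto
    ultimately show False using card_squares[where 'a='a] by linarith
  qed
  then obtain s t where "a * s\<^sup>2 = c - b * t\<^sup>2" by auto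
  then show thesis using that by (metis diff_add_cancel)
qed

lemma square_surj_char_2:
  assumes "(1::'a::{field,finite}) + 1 = 0"
  shows "surj (\<lambda>s::'a. s\<^sup>2)"
proof (rule finite_UNIV_inj_surj)
  have "2 = (0::'a)" using assms by simp
  show "inj (\<lambda>s::'a. s\<^sup>2)"
  proof (rule injI)
    fix s t :: 'a assume "s\<^sup>2 = t\<^sup>2"
    then have "(s - t)\<^sup>2 = 2 * t * (t - s)" by (simp add: power2_eq_square algebra_simps)
    then show "s = t" using \<open>2 = 0\<close> by simp
  qed
qed simp

text \<open>Multiplication by a nonzero \<open>t\<close> permutes the nonzero elements and so
  preserves their product.\<close>

lemma power_CARD:
  fixes t :: "'a::{field,finite}"
  shows "t ^ CARD('a) = t"
proof (cases "t = 0")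
  case True
  then show ?thesis by simp
next
  case False
  let ?U = "UNIV - {0::'a}"
  have "\<Prod>?U = (\<Prod>s\<in>?U. t * s)"
    by (rule prod.reindex_bij_witness[of _ "\<lambda>s. t * s" "\<lambda>s. s / t"]) (use False in auto)
  also have "\<dots> = t ^ card ?U * \<Prod>?U" by (simp add: prod.distrib)
  finally have "t ^ card ?U = 1" by simp
  moreover have "CARD('a) = Suc (card ?U)"
    by (simp add: card_Diff_singleton card_gt_0_iff)
  ultimately show ?thesis by (simp only: power_Suc mult_1_right)
qed

text \<open>Translation by 1 preserves the sum of all elements, so \<open>CARD('a)\<close> is 0 in
  the field.\<close>

lemma CHAR_of_CARD_prime_power:
  assumes "prime p" "CARD('a::{field,finite}) = p ^ k"
  shows "CHAR('a) = p"
proof -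
  have "(\<Sum>t\<in>UNIV. t + (1::'a)) = (\<Sum>t\<in>UNIV. t)"
    by (rule sum.reindex_bij_witness[of _ "\<lambda>s. s - 1" "\<lambda>s. s + 1"]) auto
  then have "of_nat CARD('a) = (0::'a)" by (simp add: sum.distrib)
  then have "CHAR('a) dvd p ^ k" using assms of_nat_eq_0_iff_char_dvd by metis
  moreover have "prime CHAR('a)"
    using prime_CHAR_semidom[where 'a='a] finite_imp_CHAR_pos[where 'a='a] by simp
  ultimately show ?thesis using assms by (metis prime_dvd_power primes_dvd_imp_eq)
qed

subsection \<open>The quadratic extension of a finite field\<close>

text \<open>Makes \<open>\<lambda>t. t ^ r\<close> a field automorphism; that it is an involution
  follows from \<open>power_CARD\<close>.\<close>

definition conjugation_exponent :: "'a::{field,finite} itself \<Rightarrow> nat \<Rightarrow> bool" where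
  "conjugation_exponent _ r \<longleftrightarrow> r \<ge> 2 \<and> CARD('a) = r * r \<and> (\<forall>s t :: 'a. (s + t) ^ r = s ^ r + t ^ r)"

context
  fixes r :: nat
  assumes conjugation_exponent: "conjugation_exponent TYPE('a::{field,finite}) r"
begin

lemma r_ge: "r \<ge> 2" and CARD_r: "CARD('a) = r * r" and conj_add: "((s::'a) + t) ^ r = s ^ r + t ^ r"
  using conjugation_exponent by (auto simp: conjugation_exponent_def)

lemma conj_conj: "((t::'a) ^ r) ^ r = t"
  using power_CARD[of t] by (simp add: CARD_r power_mult)

lemma conj_diff: "((s::'a) - t) ^ r = s ^ r - t ^ r"
  using conj_add[of "s - t" t] by simp

lemma conj_minus: "(- (s::'a)) ^ r = - (s ^ r)"
  using conj_diff[of 0 s] r_ge by simp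

lemma r_less_CARD: "r < CARD('a)"
  using r_ge by (simp add: CARD_r)

text \<open>Conjugation negates \<open>b ^ r - b\<close>, and a root count supplies a
  \<open>b\<close> that it does not fix.\<close>

lemma trace_zero: obtains c :: 'a where "c \<noteq> 0" "c + c ^ r = 0"
proof -
  have "card {t::'a. t ^ r + (- 1) * t = 0} \<le> r" by (rule card_roots_power_add_linear[OF r_ge])
  then have "{t::'a. t ^ r + (- 1) * t = 0} \<noteq> UNIV" using r_less_CARD by auto
  then obtain b :: 'a where "b ^ r - b \<noteq> 0" by auto
  then show thesis using that[of "b ^ r - b"] by (simp add: conj_diff conj_conj)
qed

text \<open>A root count gives one \<open>b\<close> of nonzero trace; a multiplier \<open>d\<close>
  fixed by conjugation rescales that trace to \<open>s\<close>.\<close>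

lemma trace_surj:
  assumes "(s::'a) ^ r = s"
  obtains c where "c + c ^ r = s"
proof -
  have "card {t::'a. t ^ r + 1 * t = 0} \<le> r" by (rule card_roots_power_add_linear[OF r_ge])
  then have "{t::'a. t ^ r + 1 * t = 0} \<noteq> UNIV" using r_less_CARD by auto
  then obtain b :: 'a where b: "b ^ r + b \<noteq> 0" by auto
  define d where "d = s / (b ^ r + b)"
  have "d ^ r = d"
    by (simp add: d_def power_divide conj_add conj_conj assms add.commute)
  then have "d * b + (d * b) ^ r = d * (b ^ r + b)" by (simp add: power_mult_distrib algebra_simps)
  also have "\<dots> = s" using b by (simp add: d_def)
  finally show thesis using that by blast
qed

text \<open>The norm sends \<open>(r + 1) * (r - 1)\<close> nonzero elements at most
  \<open>r + 1\<close> to one into the roots of \<open>t ^ (r - 1) = 1\<close>, of which there are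
  at most \<open>r - 1\<close>. So it hits them all.\<close>

lemma norm_surj:
  assumes s: "(s::'a) ^ r = s"
  obtains c where "c ^ (r + 1) = s"
proof (cases "s = 0")
  case True
  then show ?thesis using that[of 0] by simp
next
  case False
  let ?U = "UNIV - {0::'a}" and ?f = "\<lambda>c::'a. c ^ (r + 1)" and ?T = "{t::'a. t ^ (r - 1) = 1}"
  have T: "t \<in> ?T" if "t \<noteq> 0" "t ^ r = t" for t :: 'a
  proof -
    have "t * t ^ (r - 1) = t" using that r_ge by (metis One_nat_def Suc_diff_1 gr0I not_numeral_le_zero power_Suc)
    then show ?thesis using that by simp
  qed
  have "card {a\<in>?U. ?f a = b} \<le> r + 1" for b
    by (rule order_trans[OF card_mono card_power_eq_le[of "r + 1" b]]) auto
  then have "card ?U \<le> (r + 1) * card (?f ` ?U)" by (intro card_le_card_fibres) auto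
  moreover have "card ?U = (r + 1) * (r - 1)"
    using r_ge by (simp add: card_Diff_singleton CARD_r algebra_simps)
  ultimately have "(r + 1) * (r - 1) \<le> (r + 1) * card (?f ` ?U)" by (simp only:)
  then have "r - 1 \<le> card (?f ` ?U)" by (simp only: mult_le_cancel1)
  moreover have "card ?T \<le> r - 1" using r_ge by (intro card_power_eq_le) simp
  moreover have "?f ` ?U \<subseteq> ?T"
  proof
    fix t assume "t \<in> ?f ` ?U"
    then obtain c where c: "c \<noteq> 0" "t = c * c ^ r" by auto
    then have "t ^ r = t" by (simp add: power_mult_distrib conj_conj mult.commute)
    then show "t \<in> ?T" using T c by simp
  qed
  ultimately have "?f ` ?U = ?T" by (intro card_seteq) auto
  then have "s \<in> ?f ` ?U" using T[OF False s] by simp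
  then show thesis using that by blast
qed

end

lemma conjugation_exponent_prime_power:
  assumes "prime p" "n \<ge> 1" "CARD('a::{field,finite}) = p ^ (2 * n)"
  shows "conjugation_exponent TYPE('a) (p ^ n)"
  unfolding conjugation_exponent_def
proof (intro conjI allI)
  have "p \<ge> 2" using assms prime_ge_2_nat by blast
  then show "2 \<le> p ^ n" using assms by (metis le_trans self_le_power One_nat_def Suc_le_eq not_numeral_le_zero gr0I)
  show "CARD('a) = p ^ n * p ^ n" using assms by (simp add: power_add mult_2)
  have "CHAR('a) = p" using CHAR_of_CARD_prime_power assms by blast
  then show "(s + t) ^ p ^ n = s ^ p ^ n + t ^ p ^ n" for s t :: 'a
    using assms by (intro freshmans_dream') auto
qed

section \<open>The classical forms\<close>

lemma linear_functional_simps: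
  assumes "Vector_Spaces.linear scale (*) \<phi>"
  shows "\<phi> (u + v) = \<phi> u + \<phi> v" "\<phi> (scale c u) = c * \<phi> u"
  using assms by (auto simp: Vector_Spaces.linear_iff)

subsection \<open>Quadratic forms\<close>

context
  fixes scale :: "'a::{field,finite} \<Rightarrow> 'v::{ab_group_add,finite} \<Rightarrow> 'v" and Basis Q
  assumes fd: "finite_dimensional_vector_space scale Basis"
    and Q: "quadratic_form scale Q" and nd: "nondegenerate_quadratic Q"
begin

interpretation finite_dimensional_vector_space scale Basis by (rule fd)

lemma quadratic_scale: "Q (scale c v) = c\<^sup>2 * Q v"
  using Q by (simp add: quadratic_form_def)

lemma quadratic_add: "Q (u + v) = Q u + Q v + polarization Q u v"
  by (simp add: polarization_def)

lemma polarization_sym: "polarization Q u v = polarization Q v u"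
  by (simp add: polarization_def add.commute)

lemma polarization_left:
  "polarization Q (u + v) w = polarization Q u w + polarization Q v w"
  "polarization Q (scale c u) w = c * polarization Q u w"
  using Q linear_functional_simps[of scale "\<lambda>u. polarization Q u w"]
  by (auto simp: quadratic_form_def bilinear_form_def)

lemma polarization_self: "polarization Q v v = 2 * Q v"
proof -
  have "v + v = scale 2 v" using scale_left_distrib[of 1 1 v] by simp
  then have "Q (v + v) = 2\<^sup>2 * Q v" using quadratic_scale by simp
  then show ?thesis by (simp add: polarization_def)
qed

lemma quadratic_polar_geometry: "polar_geometry scale Basis (polarization Q) (\<lambda>v. Q v = 0)"
proof unfold_locales
  show "v = 0" if "Q v = 0" "\<And>u. polarization Q u v = 0" for v
    using nd that by (auto simp: nondegenerate_quadratic_def)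
  show "polarization Q v u = 0" if "polarization Q u v = 0" for u v
    using that polarization_sym by metis
qed (auto simp: polarization_left polarization_self quadratic_scale quadratic_add)

lemma quadratic_hyperbolic:
  assumes "Q a = 0" "polarization Q u a \<noteq> 0"
  shows "\<exists>b. Q (u + scale b a) = 0"
proof -
  have "polarization Q u (scale b a) = b * polarization Q u a" for b
    using polarization_left(2) polarization_sym by metis
  then have "Q (u + scale b a) = Q u + b * polarization Q u a" for b
    using assms by (simp add: quadratic_add quadratic_scale)
  then have "Q (u + scale (- Q u / polarization Q u a) a) =
      Q u + (- Q u / polarization Q u a) * polarization Q u a" .
  also have "\<dots> = 0" using assms by simp
  finally show ?thesis by blast
qed

interpretation pg: polar_geometry scale Basis "polarization Q" "\<lambda>v. Q v = 0"
  by (rule quadratic_polar_geometry)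

lemma quadratic_isotropic_iff: "isotropic scale (Quad Q) W \<longleftrightarrow> pg.tot_iso W"
proof -
  have "polarization Q u v = 0" if "subspace W" "\<forall>v\<in>W. Q v = 0" "u \<in> W" "v \<in> W" for u v
    using that by (simp add: polarization_def subspace_add)
  then show ?thesis by (auto simp: isotropic_def pg.tot_iso_def pg.orth_def)
qed

text \<open>In characteristic 2 all elements are squares and two orthogonal vectors suffice.
  Otherwise three mutually orthogonal vectors are combined by
  \<open>weighted_sum_two_squares\<close>.\<close>

lemma quadratic_singular_vector:
  assumes A: "subspace A" and d: "3 \<le> dim A"
  shows "\<exists>v\<in>A. v \<noteq> 0 \<and> Q v = 0"
proof (rule ccontr)
  assume "\<not> ?thesis"
  then have an: "Q v \<noteq> 0" if "v \<in> A" "v \<noteq> 0" for v using that by blast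
  have "\<not> A \<subseteq> {0}" using d by (simp flip: dim_eq_0)
  then obtain u where u: "u \<in> A" "u \<noteq> 0" by blast
  have d2: "2 \<le> dim (A \<inter> pg.orth {u})"
    using pg.dim_Int_orth_singleton[OF A, of u] d by simp
  have "\<not> A \<inter> pg.orth {u} \<subseteq> span {u}"
    using dim_subset[of "A \<inter> pg.orth {u}" "span {u}"] d2 u by auto
  then obtain v where v: "v \<in> A" "polarization Q v u = 0" "v \<notin> span {u}"
    by (auto simp: pg.orth_def)
  have v0: "v \<noteq> 0" using v span_zero by blast
  show False
  proof (cases "(1::'a) + 1 = 0")
    case True
    obtain c where c: "c\<^sup>2 = - Q v / Q u"
      using surjD[OF square_surj_char_2[OF True], of "- Q v / Q u"] by metis
    have "Q (scale c u + v) = 0"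
      using v c an[OF u] by (simp add: quadratic_add quadratic_scale polarization_left polarization_sym[of u v])
    moreover have "scale c u + v \<in> A" using u v A by (simp add: subspace_add subspace_scale)
    moreover have "scale c u + v \<noteq> 0"
    proof
      assume "scale c u + v = 0"
      then have "v = scale (- c) u" by (simp add: add_eq_0_iff)
      then show False using v span_base span_scale by blast
    qed
    ultimately show False using an by blast
  next
    case False
    then have two: "(2::'a) \<noteq> 0" by simp
    have "dim (A \<inter> pg.orth {u} \<inter> pg.orth {v}) \<noteq> 0"
      using pg.dim_Int_orth_singleton[OF pg.subspace_Int_orth[OF A, of "{u}"], of v] d2 by linarith
    then have "\<not> A \<inter> pg.orth {u} \<inter> pg.orth {v} \<subseteq> {0}" by (simp only: dim_eq_0 not_False_eq_True)
    then obtain w where w: "w \<in> A" "w \<noteq> 0" "polarization Q w u = 0" "polarization Q w v = 0"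
      by (auto simp: pg.orth_def)
    obtain s t where st: "Q u * s\<^sup>2 + Q v * t\<^sup>2 = - Q w"
      using weighted_sum_two_squares[OF an[OF u] an[OF v(1) v0]] by blast
    let ?x = "scale s u + scale t v + w"
    have uv: "polarization Q u v = 0" "polarization Q u w = 0" "polarization Q v w = 0"
      "polarization Q u (scale t v) = 0"
      using v w by (simp_all add: polarization_sym[of u] polarization_sym[of v w] polarization_left)
    have "Q ?x = Q u * s\<^sup>2 + Q v * t\<^sup>2 + Q w"
      using uv by (simp add: quadratic_add quadratic_scale polarization_left)
    then have "Q ?x = 0" using st by simp
    moreover have "?x \<in> A" using u v w A by (simp add: subspace_add subspace_scale)
    \<comment> \<open>\<open>A\<close> is assumed anisotropic, so the singular combination vanishes;
      pairing it with \<open>u\<close> and \<open>v\<close> kills \<open>s\<close> and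
      \<open>t\<close>.\<close>
    ultimately have x0: "?x = 0" using an by blast
    have "polarization Q ?x u = s * (2 * Q u)" "polarization Q ?x v = t * (2 * Q v)"
      using uv v w by (simp_all add: polarization_left polarization_self)
    then have "s = 0" "t = 0" using x0 an[OF u] an[OF v(1) v0] two by auto
    then show False using x0 w by simp
  qed
qed

end

subsection \<open>Alternating forms\<close>

context
  fixes scale :: "'a::{field,finite} \<Rightarrow> 'v::{ab_group_add,finite} \<Rightarrow> 'v" and Basis B
  assumes fd: "finite_dimensional_vector_space scale Basis"
    and B: "alternating_form scale B" and nd: "nondegenerate_sesq B"
begin

interpretation finite_dimensional_vector_space scale Basis by (rule fd)

lemma alternating_polar_geometry: "polar_geometry scale Basis B (\<lambda>_. True)"
proof unfold_locales
  have lin: "Vector_Spaces.linear scale (*) (\<lambda>v. B u v)" "Vector_Spaces.linear scale (*) (\<lambda>u. B u v)" for u v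
    using B by (auto simp: alternating_form_def bilinear_form_def)
  show add: "B (u + v) w = B u w + B v w" for u v w
    using linear_functional_simps[OF lin(2)] by blast
  show "B (scale c u) w = c * B u w" for c u w
    using linear_functional_simps[OF lin(2)] by blast
  show self: "B v v = 0" for v using B by (simp add: alternating_form_def)
  \<comment> \<open>Expand \<open>B (u + v) (u + v) = 0\<close>.\<close>
  show "B v u = 0" if "B u v = 0" for u v
    using self[of "u + v"] that self[of u] self[of v] linear_functional_simps(1)[OF lin(1)] by (simp add: add)
  show "v = 0" if "\<And>u. B u v = 0" for v using nd that by (auto simp: nondegenerate_sesq_def)
qed auto

interpretation pg: polar_geometry scale Basis B "\<lambda>_. True"
  by (rule alternating_polar_geometry)

lemma alternating_isotropic_iff: "isotropic scale (Sesq B) W \<longleftrightarrow> pg.tot_iso W"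
  by (auto simp: isotropic_def pg.tot_iso_def pg.orth_def)

end

subsection \<open>Hermitian forms\<close>

context
  fixes scale :: "'a::{field,finite} \<Rightarrow> 'v::{ab_group_add,finite} \<Rightarrow> 'v" and Basis H r
  assumes fd: "finite_dimensional_vector_space scale Basis"
    and r: "conjugation_exponent TYPE('a) r"
    and H: "hermitian_form r scale H" and nd: "nondegenerate_sesq H"
begin

interpretation finite_dimensional_vector_space scale Basis by (rule fd)

lemmas conj_simps = conj_add[OF r] conj_minus[OF r]

lemma hermitian_left: "H (u + v) w = H u w + H v w" "H (scale c u) w = c * H u w"
  using H linear_functional_simps[of scale "\<lambda>u. H u w"] unfolding hermitian_form_def by blast+

lemma hermitian_conj: "H v u = H u v ^ r"
  using H unfolding hermitian_form_def by blast

lemma hermitian_zero_sym: "H u v = 0 \<Longrightarrow> H v u = 0"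
  using hermitian_conj[of v u] r_ge[OF r] by simp

lemma hermitian_right: "H w (u + scale c v) = H w u + c ^ r * H w v"
  by (simp add: hermitian_conj[of w] hermitian_left conj_simps power_mult_distrib)

lemma hermitian_polar_geometry: "polar_geometry scale Basis H (\<lambda>v. H v v = 0)"
proof unfold_locales
  show sym: "H v u = 0" if "H u v = 0" for u v using that by (rule hermitian_zero_sym)
  show "H (scale c v) (scale c v) = 0" if "H v v = 0" for c v
    using that sym[of "scale c v" v] by (simp add: hermitian_left)
  show "H (u + v) (u + v) = 0" if "H u u = 0" "H v v = 0" "H u v = 0" for u v
    using that sym[OF that(3)] hermitian_right[of "u + v" u 1 v] by (simp add: hermitian_left)
  show "v = 0" if "\<And>u. H u v = 0" for v using nd that by (auto simp: nondegenerate_sesq_def)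
qed (auto simp: hermitian_left)

interpretation pg: polar_geometry scale Basis H "\<lambda>v. H v v = 0"
  by (rule hermitian_polar_geometry)

lemma hermitian_isotropic_iff: "isotropic scale (Sesq H) W \<longleftrightarrow> pg.tot_iso W"
  by (auto simp: isotropic_def pg.tot_iso_def pg.orth_def)

text \<open>Adding a multiple of a singular vector changes the form by a trace, so singularity
  becomes a trace equation.\<close>

lemma hermitian_add_scale:
  assumes "H a a = 0"
  shows "H (u + scale b a) (u + scale b a) = H u u + (b * H a u + (b * H a u) ^ r)"
proof -
  have "H u a = H a u ^ r" by (rule hermitian_conj)
  then show ?thesis
    using assms by (simp add: hermitian_right hermitian_left power_mult_distrib algebra_simps)
qed

lemma hermitian_hyperbolic:
  assumes "H a a = 0" "H u a \<noteq> 0"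
  shows "\<exists>b. H (u + scale b a) (u + scale b a) = 0"
proof -
  have "(- H u u) ^ r = - H u u" using hermitian_conj[of u u, symmetric] by (simp add: conj_simps)
  then obtain c where c: "c + c ^ r = - H u u" using trace_surj[OF r] by blast
  have "H a u \<noteq> 0" using assms hermitian_zero_sym by blast
  then have "H (u + scale (c / H a u) a) (u + scale (c / H a u) a) = 0"
    using c by (simp add: hermitian_add_scale[OF assms(1)])
  then show ?thesis by blast
qed

text \<open>A nonzero element of trace 0, divided by \<open>H a e\<close>, serves as
  \<open>c\<close>.\<close>

lemma hermitian_nonbipartite:
  assumes "H a a = 0" "H e e = 0" "H a e \<noteq> 0"
  shows "\<exists>c. c \<noteq> 0 \<and> H (e + scale c a) (e + scale c a) = 0"
proof -
  obtain c :: 'a where c: "c \<noteq> 0" "c + c ^ r = 0" using trace_zero[OF r] by blast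
  have "H (e + scale (c / H a e) a) (e + scale (c / H a e) a) = 0"
    using c assms by (simp add: hermitian_add_scale)
  moreover have "c / H a e \<noteq> 0" using c assms by simp
  ultimately show ?thesis by blast
qed

text \<open>For orthogonal \<open>u\<close> and \<open>v\<close> with \<open>v\<close> not singular,
  \<open>u + scale c v\<close> is singular once the norm of \<open>c\<close> is
  \<open>- H u u / H v v\<close>.\<close>

lemma hermitian_singular_vector:
  assumes A: "subspace A" and d: "2 \<le> dim A"
  shows "\<exists>v\<in>A. v \<noteq> 0 \<and> H v v = 0"
proof -
  have "\<not> A \<subseteq> {0}" using d by (simp flip: dim_eq_0)
  then obtain v where v: "v \<in> A" "v \<noteq> 0" by blast
  have "dim (A \<inter> pg.orth {v}) \<noteq> 0" using pg.dim_Int_orth_singleton[OF A, of v] d by linarith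
  then have "\<not> A \<inter> pg.orth {v} \<subseteq> {0}" by (simp only: dim_eq_0 not_False_eq_True)
  then obtain u where u: "u \<in> A" "u \<noteq> 0" "H u v = 0" by (auto simp: pg.orth_def)
  show ?thesis
  proof (cases "H v v = 0")
    case True
    then show ?thesis using v by blast
  next
    case False
    have "(- H u u / H v v) ^ r = - H u u / H v v"
      using hermitian_conj[of u u, symmetric] hermitian_conj[of v v, symmetric] by (simp add: power_divide conj_simps)
    then obtain c where c: "c ^ (r + 1) = - H u u / H v v" using norm_surj[OF r] by blast
    let ?w = "u + scale c v"
    have "H ?w ?w = H u u + c ^ (r + 1) * H v v"
      using u hermitian_zero_sym[OF u(3)] by (simp add: hermitian_right hermitian_left algebra_simps)
    then have "H ?w ?w = 0" using c False by simp
    moreover have "?w \<noteq> 0"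
    proof
      assume w: "?w = 0"
      have "c * H v v = H ?w v" using u by (simp add: hermitian_left)
      also have "\<dots> = 0" using w hermitian_left(2)[of 0 0 v] by simp
      finally have "c = 0" using False by simp
      then show False using w u by simp
    qed
    moreover have "?w \<in> A" using u v A by (simp add: subspace_add subspace_scale)
    ultimately show ?thesis by blast
  qed
qed

end

section \<open>The equivalence classes\<close>

lemma char_vec_eq: "finite C \<Longrightarrow> char_vec C w = (if w \<in> C then 1 else 0)"
  unfolding char_vec_def std_basis_def by (simp add: sum.delta')

lemma char_vec_inject:
  assumes "finite A" "finite C" "char_vec A = char_vec C"
  shows "A = C"
proof -
  have "w \<in> A \<longleftrightarrow> w \<in> C" for w
    using fun_cong[OF assms(3), of w] assms(1,2) by (simp add: char_vec_eq split: if_splits)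
  then show ?thesis by blast
qed

context nonbipartite_dual_polar
begin

text \<open>By \<open>edges_Int_eq\<close> the intersection with \<open>x\<close> is constant along
  a path inside a subconstituent. Conversely, a path from \<open>opposite_connected\<close> stays at
  one distance from \<open>x\<close>.\<close>

lemma sim_rel_edges:
  assumes x: "max_iso x"
  shows "sim_rel {y. max_iso y} edges x = {(y, z). max_iso y \<and> max_iso z \<and> x \<inter> y = x \<inter> z}"
proof (intro set_eqI iffI; clarify)
  fix y z assume "(y, z) \<in> sim_rel {y. max_iso y} edges x"
  then have y: "max_iso y" and z: "max_iso z"
    and p: "(y, z) \<in> (Restr edges (subconstituent {y. max_iso y} edges x (graph_dist edges x y)))\<^sup>*"
    by (auto simp: sim_rel_def)
  from p have "x \<inter> y = x \<inter> z"
  proof (induction rule: rtrancl_induct)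
    case base
    show ?case by simp
  next
    case (step u w)
    then have uw: "(u, w) \<in> edges" "max_iso u" "max_iso w" "graph_dist edges x u = graph_dist edges x w"
      by (auto simp: subconstituent_def)
    have "dim (x \<inter> u) \<le> D" "dim (x \<inter> w) \<le> D"
      using max_iso_dim[OF x] dim_subset[OF Int_lower1] by metis+
    then have "dim (x \<inter> u) = dim (x \<inter> w)" using uw graph_dist_edges[OF x] by simp
    then show ?case using edges_Int_eq[OF x uw(1)] step.IH by simp
  qed
  then show "max_iso y \<and> max_iso z \<and> x \<inter> y = x \<inter> z" using y z by blast
next
  fix y z assume y: "max_iso y" and z: "max_iso z" and eq: "x \<inter> y = x \<inter> z"
  let ?S = "subconstituent {y. max_iso y} edges x (graph_dist edges x y)"
  have "opposite x (x \<inter> y) \<subseteq> ?S"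
    using graph_dist_edges[OF x] y by (auto simp: opposite_def subconstituent_def)
  then have "Restr edges (opposite x (x \<inter> y)) \<subseteq> Restr edges ?S" by blast
  moreover have "(y, z) \<in> (Restr edges (opposite x (x \<inter> y)))\<^sup>*"
    using x y z eq by (intro opposite_connected) (auto simp: opposite_def)
  ultimately have "(y, z) \<in> (Restr edges ?S)\<^sup>*" using rtrancl_mono by blast
  then show "(y, z) \<in> sim_rel {y. max_iso y} edges x"
    using y z eq graph_dist_edges[OF x] by (simp add: sim_rel_def)
qed

lemma sim_rel_quotient:
  assumes x: "max_iso x"
  shows "{y. max_iso y} // sim_rel {y. max_iso y} edges x = opposite x ` {\<eta>. subspace \<eta> \<and> \<eta> \<subseteq> x}"
proof -
  have cls: "sim_rel {y. max_iso y} edges x `` {y} = opposite x (x \<inter> y)" if "max_iso y" for y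
    using that by (auto simp: sim_rel_edges[OF x] opposite_def)
  show ?thesis
  proof (intro set_eqI iffI)
    fix C assume "C \<in> {y. max_iso y} // sim_rel {y. max_iso y} edges x"
    then obtain y where y: "max_iso y" "C = opposite x (x \<inter> y)" using cls by (auto elim: quotientE)
    moreover have "subspace (x \<inter> y)" using x y by (simp add: max_iso_subspace subspace_inter)
    ultimately show "C \<in> opposite x ` {\<eta>. subspace \<eta> \<and> \<eta> \<subseteq> x}" by blast
  next
    fix C assume "C \<in> opposite x ` {\<eta>. subspace \<eta> \<and> \<eta> \<subseteq> x}"
    then obtain \<eta> where \<eta>: "subspace \<eta>" "\<eta> \<subseteq> x" "C = opposite x \<eta>" by blast
    have "tot_iso \<eta>" using \<eta> x max_iso_tot_iso tot_iso_subset by blast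
    then obtain y where "max_iso y" "x \<inter> y = x \<inter> \<eta>" using opposite_nonempty[OF _ x] by blast
    then have "max_iso y" "C = opposite x (x \<inter> y)" using \<eta> by (auto simp: Int_absorb1)
    then have "C = sim_rel {y. max_iso y} edges x `` {y}" using cls by simp
    then show "C \<in> {y. max_iso y} // sim_rel {y. max_iso y} edges x"
      using \<open>max_iso y\<close> by (auto intro: quotientI)
  qed
qed

text \<open>Classes are nonempty, and any member \<open>y\<close> recovers \<open>\<eta>\<close> as
  \<open>x \<inter> y\<close>; this gives injectivity. The hypothesis \<open>iso\<close> transfers
  the result to each concrete form.\<close>

theorem bij_betw_eta_N:
  assumes iso: "\<And>W. isotropic scale f W \<longleftrightarrow> tot_iso W" and x: "x \<in> dp_vertices scale f"
  shows "bij_betw (eta_N (dp_vertices scale f) x) {\<eta>. subspace \<eta> \<and> \<eta> \<subseteq> x}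
    (char_vec ` (dp_vertices scale f // sim_rel (dp_vertices scale f) (dp_edges scale f D) x))"
proof -
  have V: "dp_vertices scale f = {y. max_iso y}"
    by (auto simp: dp_vertices_def max_iso_def iso)
  have E: "dp_edges scale f D = edges"
    by (simp add: dp_edges_def V edges_def)
  have mx: "max_iso x" using x V by simp
  have eta: "eta_N {y. max_iso y} x \<eta> = char_vec (opposite x \<eta>)" for \<eta>
    by (simp add: eta_N_def char_vec_def opposite_def)
  show ?thesis
    unfolding V E
  proof (rule bij_betw_imageI)
    show "inj_on (eta_N {y. max_iso y} x) {\<eta>. subspace \<eta> \<and> \<eta> \<subseteq> x}"
    proof (rule inj_onI)
      fix \<eta> \<theta> assume \<eta>: "\<eta> \<in> {\<eta>. subspace \<eta> \<and> \<eta> \<subseteq> x}"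
        and eq: "eta_N {y. max_iso y} x \<eta> = eta_N {y. max_iso y} x \<theta>"
      have "tot_iso \<eta>" using \<eta> mx max_iso_tot_iso tot_iso_subset by blast
      then obtain y where "max_iso y" "x \<inter> y = x \<inter> \<eta>" using opposite_nonempty[OF _ mx] by blast
      then have "y \<in> opposite x \<eta>" using \<eta> by (auto simp: opposite_def)
      moreover have "opposite x \<eta> = opposite x \<theta>"
        using eq by (intro char_vec_inject) (auto simp: eta)
      ultimately show "\<eta> = \<theta>" by (auto simp: opposite_def)
    qed
    show "eta_N {y. max_iso y} x ` {\<eta>. subspace \<eta> \<and> \<eta> \<subseteq> x} =
        char_vec ` ({y. max_iso y} // sim_rel {y. max_iso y} edges x)"
      unfolding sim_rel_quotient[OF mx] image_image eta ..
  qed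
qed

end

section \<open>The classical forms as instances\<close>

lemma vector_space_finite_Basis:
  fixes scale :: "'a::field \<Rightarrow> 'v::{ab_group_add,finite} \<Rightarrow> 'v"
  assumes "vector_space scale"
  obtains Basis where "finite_dimensional_vector_space scale Basis"
proof -
  interpret vector_space scale by (rule assms)
  obtain Basis where "independent Basis" "UNIV \<subseteq> span Basis"
    using maximal_independent_subset[of UNIV] by blast
  then have "finite_dimensional_vector_space scale Basis"
    by unfold_locales auto
  then show thesis by (rule that)
qed

lemma nonbipartite_dual_polar_quadratic:
  fixes scale :: "'a::{field,finite} \<Rightarrow> 'v::{ab_group_add,finite} \<Rightarrow> 'v"
  assumes fd: "finite_dimensional_vector_space scale Basis"
    and Q: "quadratic_form scale Q" "nondegenerate_quadratic Q" and D: "D \<ge> 1"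
    and dim: "vector_space.dim scale (UNIV :: 'v set) = 2 * D + 1 \<or>
      vector_space.dim scale (UNIV :: 'v set) = 2 * D + 2 \<and> witt_index scale (Quad Q) = D"
  shows "nonbipartite_dual_polar scale Basis (polarization Q) (\<lambda>v. Q v = 0) D"
proof -
  interpret polar_geometry scale Basis "polarization Q" "\<lambda>v. Q v = 0"
    using fd Q by (rule quadratic_polar_geometry)
  show ?thesis
  proof
    show "dim y = D" if y: "max_iso y" for y
      using dim
    proof
      assume "dim (UNIV :: 'v set) = 2 * D + 1"
      moreover have "dim (UNIV :: 'v set) < 2 * dim y + 3"
        using y quadratic_singular_vector[OF fd Q] by (rule max_iso_dim_lower)
      moreover have "2 * dim y \<le> dim (UNIV :: 'v set)"
        using y by (intro tot_iso_dim_le max_iso_tot_iso)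
      ultimately show ?thesis by linarith
    next
      \<comment> \<open>Singular vectors in dimension 3 leave both \<open>D\<close> and
        \<open>D + 1\<close> possible for \<open>dim y\<close>; the Witt index decides, because all
        maximal subspaces have equal dimension.\<close>
      assume w: "dim (UNIV :: 'v set) = 2 * D + 2 \<and> witt_index scale (Quad Q) = D"
      have "Max (dim ` {W. isotropic scale (Quad Q) W}) = dim y"
      proof (rule Max_eqI)
        show "d \<le> dim y" if "d \<in> dim ` {W. isotropic scale (Quad Q) W}" for d
          using that max_iso_dim_ge[OF y] quadratic_isotropic_iff[OF fd Q] by auto
        show "dim y \<in> dim ` {W. isotropic scale (Quad Q) W}"
          using max_iso_tot_iso[OF y] quadratic_isotropic_iff[OF fd Q] by blast
      qed simp
      then show ?thesis using w by (simp add: witt_index_def)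
    qed
    show "2 * D < dim (UNIV :: 'v set) \<or>
      (\<forall>a e. Q a = 0 \<longrightarrow> Q e = 0 \<longrightarrow> polarization Q a e \<noteq> 0 \<longrightarrow> (\<exists>c. c \<noteq> 0 \<and> Q (e + scale c a) = 0))"
      using dim by linarith
  qed (use D quadratic_hyperbolic[OF fd Q] in auto)
qed

lemma nonbipartite_dual_polar_alternating:
  fixes scale :: "'a::{field,finite} \<Rightarrow> 'v::{ab_group_add,finite} \<Rightarrow> 'v"
  assumes fd: "finite_dimensional_vector_space scale Basis"
    and B: "alternating_form scale B" "nondegenerate_sesq B" and D: "D \<ge> 1"
    and dim: "vector_space.dim scale (UNIV :: 'v set) = 2 * D"
  shows "nonbipartite_dual_polar scale Basis B (\<lambda>_. True) D"
proof -
  interpret polar_geometry scale Basis B "\<lambda>_. True"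
    using fd B by (rule alternating_polar_geometry)
  show ?thesis
  proof
    show "dim y = D" if y: "max_iso y" for y
    proof -
      have "\<exists>v\<in>A. v \<noteq> 0 \<and> True" if "1 \<le> dim A" for A
      proof -
        have "\<not> A \<subseteq> {0}" using that by (simp flip: dim_eq_0)
        then show ?thesis by blast
      qed
      then have "dim (UNIV :: 'v set) < 2 * dim y + 1" by (intro max_iso_dim_lower[OF y])
      moreover have "2 * dim y \<le> dim (UNIV :: 'v set)"
        using y by (intro tot_iso_dim_le max_iso_tot_iso)
      ultimately show ?thesis using dim by linarith
    qed
    show "2 * D < dim (UNIV :: 'v set) \<or>
      (\<forall>a e. True \<longrightarrow> True \<longrightarrow> B a e \<noteq> 0 \<longrightarrow> (\<exists>c::'a. c \<noteq> 0 \<and> True))"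
      by (auto intro: exI[of _ 1])
  qed (use D in auto)
qed

lemma nonbipartite_dual_polar_hermitian:
  fixes scale :: "'a::{field,finite} \<Rightarrow> 'v::{ab_group_add,finite} \<Rightarrow> 'v"
  assumes fd: "finite_dimensional_vector_space scale Basis"
    and r: "conjugation_exponent TYPE('a) r"
    and H: "hermitian_form r scale H" "nondegenerate_sesq H" and D: "D \<ge> 1"
    and dim: "vector_space.dim scale (UNIV :: 'v set) = 2 * D \<or>
      vector_space.dim scale (UNIV :: 'v set) = 2 * D + 1"
  shows "nonbipartite_dual_polar scale Basis H (\<lambda>v. H v v = 0) D"
proof -
  interpret polar_geometry scale Basis H "\<lambda>v. H v v = 0"
    using fd r H by (rule hermitian_polar_geometry)
  show ?thesis
  proof
    show "dim y = D" if y: "max_iso y" for y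
    proof -
      have "dim (UNIV :: 'v set) < 2 * dim y + 2"
        using y hermitian_singular_vector[OF fd r H] by (rule max_iso_dim_lower)
      moreover have "2 * dim y \<le> dim (UNIV :: 'v set)"
        using y by (intro tot_iso_dim_le max_iso_tot_iso)
      ultimately show ?thesis using dim by (elim disjE) linarith+
    qed
    show "2 * D < dim (UNIV :: 'v set) \<or>
      (\<forall>a e. H a a = 0 \<longrightarrow> H e e = 0 \<longrightarrow> H a e \<noteq> 0 \<longrightarrow>
        (\<exists>c. c \<noteq> 0 \<and> H (e + scale c a) (e + scale c a) = 0))"
      using hermitian_nonbipartite[OF fd r H] by blast
  qed (use D hermitian_hyperbolic[OF fd r H] in auto)
qed

theorem theorem13p10:
  fixes scale :: "'a::{field,finite} \<Rightarrow> 'v::{ab_group_add,finite} \<Rightarrow> 'v"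
    and f :: "('a, 'v) form"
    and t :: polar_type
    and p n D :: nat
    and x :: "'v set"
  assumes "prime p" and "n \<ge> 1" and "D \<ge> 1"
    and "polar_space t p n D scale f"
    and "polar_e t \<noteq> -1"
    and "x \<in> dp_vertices scale f"
  shows "bij_betw (eta_N (dp_vertices scale f) x)
           {\<eta>. module.subspace scale \<eta> \<and> \<eta> \<subseteq> x}
           (char_vec ` (dp_vertices scale f // sim_rel (dp_vertices scale f) (dp_edges scale f D) x))"
proof -
  have ps: "vector_space scale" "CARD('a) = polar_q t p n"
    "vector_space.dim scale (UNIV :: 'v set) = polar_dim t D" "polar_form t p n D scale f"
    using assms(4) by (auto simp: polar_space_def)
  obtain Basis where fd: "finite_dimensional_vector_space scale Basis"
    using vector_space_finite_Basis[OF ps(1)] by blast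
  have quadratic: ?thesis
    if "t = Type_B \<or> t = Type_2D" and f: "f = Quad Q" for Q
  proof -
    have Q: "quadratic_form scale Q" "nondegenerate_quadratic Q"
      using that ps(4) by auto
    interpret nonbipartite_dual_polar scale Basis "polarization Q" "\<lambda>v. Q v = 0" D
      using that ps by (intro nonbipartite_dual_polar_quadratic[OF fd Q assms(3)]) auto
    show ?thesis
      using quadratic_isotropic_iff[OF fd Q] assms(6) unfolding f by (rule bij_betw_eta_N)
  qed
  have alternating: ?thesis if "t = Type_C" and f: "f = Sesq B" for B
  proof -
    have B: "alternating_form scale B" "nondegenerate_sesq B"
      using that ps(4) by auto
    interpret nonbipartite_dual_polar scale Basis B "\<lambda>_. True" D
      using that ps by (intro nonbipartite_dual_polar_alternating[OF fd B assms(3)]) auto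
    show ?thesis
      using alternating_isotropic_iff[OF fd B] assms(6) unfolding f by (rule bij_betw_eta_N)
  qed
  have hermitian: ?thesis if t: "t = Type_2A_even \<or> t = Type_2A_odd" and f: "f = Sesq H" for H
  proof -
    have H: "hermitian_form (p ^ n) scale H" "nondegenerate_sesq H"
      using that ps(4) by auto
    have r: "conjugation_exponent TYPE('a) (p ^ n)"
      using t ps(2) by (intro conjugation_exponent_prime_power assms) auto
    interpret nonbipartite_dual_polar scale Basis H "\<lambda>v. H v v = 0" D
      using that ps by (intro nonbipartite_dual_polar_hermitian[OF fd r H assms(3)]) auto
    show ?thesis
      using hermitian_isotropic_iff[OF fd r H] assms(6) unfolding f by (rule bij_betw_eta_N)
  qed
  show ?thesis
    \<comment> \<open>Type D is excluded by \<open>polar_e t \<noteq> -1\<close>, and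
      \<open>polar_form\<close> is false when the type and the kind of form do not match.\<close>
    using quadratic alternating hermitian ps(4) assms(5) by (cases t; cases f) auto
qed

end
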